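(* Let $A$ be an expanding $d\times d$ integral matrix whose eigenvalue of least absolute value has absolute value $\lambda>1$. There is a constant $C>0$ depending only on $A$ such that for all $f,g\in L^2(\mu)$ and all $n\ge 1$, $$|\rho_{f,g}(n)|\le C\,\|g\|_2\,\Omega_{f,2}(\lambda^{-n}),$$ where $\rho_{f,g}(n)=\int f\cdot g\circ A^n\,d\mu-\int f\,d\mu\int g\,d\mu$.
   Context: $\mathbb{T}^d=\mathbb{R}^d/\mathbb{Z}^d$ ($d\ge1$), $\mu$ is the normalized Haar (Lebesgue) measure on $\mathbb{T}^d$, and $\|\cdot\|_r$ is the norm of $L^r(\mu)$. A $d\times d$ matrix $A$ with integer entries acts as an endomorphism of $\mathbb{T}^d$; it is called expanding if all its eigenvalues have absolute value strictly greater than $1$. For $1\le r<\infty$ and $f\in L^r(\mu)$, the modulus of $L^r$-continuity is $\Omega_{f,r}(\delta)=\sup_{v\in\mathbb{R}^d,\,|v|\le\delta}\|f(\cdot+v)-f(\cdot)\|_r$, where $|v|$ is the Euclidean norm. *)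

theory Defs
  imports "HOL-Analysis.Analysis"
begin

text \<open>The torus T^d = R^d/Z^d is modelled by Z^d-periodic functions on real^'n;
  the normalized Haar measure is Lebesgue measure on the unit cube [0,1]^d.\<close>

definition int_vec :: "real^'n \<Rightarrow> bool" where
  "int_vec k \<longleftrightarrow> (\<forall>i. k $ i \<in> \<int>)"

definition torus_mu :: "(real^'n) measure" where
  "torus_mu = lebesgue_on (cbox 0 One)"

definition periodic_fun :: "(real^'n \<Rightarrow> 'b) \<Rightarrow> bool" where
  "periodic_fun f \<longleftrightarrow> (\<forall>x k. int_vec k \<longrightarrow> f (x + k) = f x)"

definition L2_torus :: "(real^'n \<Rightarrow> complex) set" where
  "L2_torus = {f. f \<in> borel_measurable lebesgue \<and> periodic_fun f \<and>
                  integrable torus_mu (\<lambda>x. (cmod (f x))\<^sup>2)}"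

definition L2_norm :: "(real^'n \<Rightarrow> complex) \<Rightarrow> real" where
  "L2_norm f = sqrt (\<integral>x. (cmod (f x))\<^sup>2 \<partial>torus_mu)"

definition L2_modulus :: "(real^'n \<Rightarrow> complex) \<Rightarrow> real \<Rightarrow> real" where
  "L2_modulus f \<delta> = Sup {L2_norm (\<lambda>x. f (x + v) - f x) | v. norm v \<le> \<delta>}"

definition int_matrix :: "real^'n^'n \<Rightarrow> bool" where
  "int_matrix A \<longleftrightarrow> (\<forall>i j. A $ i $ j \<in> \<int>)"

definition cmatrix :: "real^'n^'n \<Rightarrow> complex^'n^'n" where
  "cmatrix A = (\<chi> i j. complex_of_real (A $ i $ j))"

definition eigenvalues :: "real^'n^'n \<Rightarrow> complex set" where
  "eigenvalues A = {z. \<exists>v. v \<noteq> 0 \<and> cmatrix A *v v = z *s v}"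

definition expanding :: "real^'n^'n \<Rightarrow> bool" where
  "expanding A \<longleftrightarrow> (\<forall>z \<in> eigenvalues A. cmod z > 1)"

definition correlation :: "real^'n^'n \<Rightarrow> (real^'n \<Rightarrow> complex) \<Rightarrow> (real^'n \<Rightarrow> complex) \<Rightarrow> nat \<Rightarrow> complex" where
  "correlation A f g n =
     (\<integral>x. f x * g (((\<lambda>y. A *v y) ^^ n) x) \<partial>torus_mu)
     - (\<integral>x. f x \<partial>torus_mu) * (\<integral>x. g x \<partial>torus_mu)"

end

theory Submission
  imports Defs
    "HOL-Computational_Algebra.Fundamental_Theorem_Algebra"
    "HOL-Computational_Algebra.Polynomial_Factorial"
    "HOL-Computational_Algebra.Field_as_Ring"
begin

text \<open>
  Put \<open>I w = \<integral> f (x + w) g (A\<^sup>n x) dx\<close>. If \<open>A\<^sup>n v\<close> is an integer vector, then \<open>I (w + v) = I w\<close>. Every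
  \<open>w\<close> lies within \<open>R lam\<^sup>-\<^sup>n\<close> of such a \<open>v\<close>, so \<open>\<bar>I w - I 0\<bar>\<close> is bounded by a multiple of
  \<open>\<parallel>g\<parallel>\<^sub>2 \<Omega>\<^sub>f (lam\<^sup>-\<^sup>n)\<close> for all \<open>w\<close>. The average of \<open>I\<close> over the torus is \<open>\<integral> f \<integral> g\<close> by Fubini.

  The density of the lattice \<open>A\<^sup>-\<^sup>n \<int>\<^sup>d\<close> uses a squarefree integer polynomial \<open>q\<close> whose roots are the
  eigenvalues of \<open>A\<close>: the matrix \<open>q(A)\<close> is nilpotent, and \<open>A\<^sup>-\<^sup>n\<close> is of order \<open>lam\<^sup>-\<^sup>n\<close> modulo the image
  of \<open>q(A)\<close>.
\<close>

subsection \<open>Polynomials acting through a matrix\<close>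

text \<open>\<open>act M p x\<close> is \<open>p(M) x\<close>, evaluated by Horner's scheme so that no powers of the matrix occur.\<close>

definition act :: "'a::field^'n^'n \<Rightarrow> 'a poly \<Rightarrow> 'a^'n \<Rightarrow> 'a^'n" where
  "act M p = fold_coeffs (\<lambda>a g x. a *s x + M *v g x) p (\<lambda>x. 0)"

lemma act_0 [simp]: "act M 0 x = 0"
  by (simp add: act_def)

lemma act_pCons [simp]: "act M (pCons a p) x = a *s x + M *v act M p x"
  by (cases "p = 0"; cases "a = 0") (simp_all add: act_def fold_coeffs_pCons_eq)

lemma act_1 [simp]: "act M 1 x = x"
  by (simp add: one_pCons)

lemma act_add_poly: "act M (p + q) x = act M p x + act M q x"
  by (induction p q rule: poly_induct2)
     (simp_all add: vector_sadd_rdistrib matrix_vector_right_distrib algebra_simps)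

lemma act_smult: "act M (smult c p) x = c *s act M p x"
  by (induction p) (simp_all add: vector_add_ldistrib vector_scalar_commute vector_smult_assoc)

lemma act_add: "act M p (x + y) = act M p x + act M p y"
  by (induction p) (simp_all add: vector_add_ldistrib matrix_vector_right_distrib algebra_simps)

lemma act_scale: "act M p (c *s x) = c *s act M p x"
  by (induction p)
     (simp_all add: vector_add_ldistrib vector_scalar_commute vector_smult_assoc mult.commute)

lemma act_zero [simp]: "act M p 0 = 0"
  by (induction p) simp_all

lemma act_matrix_commute: "act M p (M *v x) = M *v act M p x"
  by (induction p) (simp_all add: matrix_vector_right_distrib vector_scalar_commute)

lemma act_mult: "act M (p * q) x = act M p (act M q x)"
  by (induction p) (simp_all add: mult_pCons_left act_add_poly act_smult)

lemma act_sum: "act M (sum p S) x = (\<Sum>i\<in>S. act M (p i) x)"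
  by (induction S rule: infinite_finite_induct) (simp_all add: act_add_poly)

lemma act_sum_vec: "act M p (sum x S) = (\<Sum>i\<in>S. act M p (x i))"
  by (induction S rule: infinite_finite_induct) (simp_all add: act_add)

lemma act_X_power: "act M ([:0, 1:] ^ n) x = (((*v) M) ^^ n) x"
  by (induction n) (simp_all add: act_mult)

lemma act_power: "act M (p ^ n) x = ((act M p) ^^ n) x"
  by (induction n) (simp_all add: act_mult)

lemma act_eigenvector: "M *v x = z *s x \<Longrightarrow> act M p x = poly p z *s x"
  by (induction p)
     (simp_all add: vector_scalar_commute vector_smult_assoc vector_sadd_rdistrib mult.commute)

lemma act_basis_zero:
  assumes "\<And>i. act M p (axis i 1) = 0"
  shows "act M p x = 0"
proof -
  have "act M p x = act M p (\<Sum>i\<in>UNIV. (x $ i) *s axis i 1)"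
    by (simp only: basis_expansion)
  also have "\<dots> = 0"
    by (simp add: act_sum_vec act_scale assms)
  finally show ?thesis .
qed

text \<open>The \<open>CARD('n) + 1\<close> vectors \<open>x\<close>, \<open>M x\<close>,
  \<open>M^2 x\<close>, ... are linearly dependent, and a dependence relation is a polynomial
  killing \<open>x\<close>.\<close>

lemma ex_annihilating_poly:
  fixes M :: "'a::field^'n^'n"
  shows "\<exists>p. p \<noteq> 0 \<and> act M p x = 0"
proof (cases "inj_on (\<lambda>i. (((*v) M) ^^ i) x) {..CARD('n)}")
  \<comment> \<open>Dependence is a property of the set of these vectors, so a coincidence between
    two of them is treated apart: the difference of two monomials then kills
    \<open>x\<close>.\<close>
  case False
  then obtain i j where ij: "i \<noteq> j" "(((*v) M) ^^ i) x = (((*v) M) ^^ j) x"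
    by (auto simp: inj_on_def)
  have "monom 1 i - monom 1 j \<noteq> (0 :: 'a poly)"
    using ij(1) by (simp add: monom_eq_iff')
  moreover have "act M (monom 1 i + smult (-1) (monom 1 j)) x = 0"
    using ij(2) unfolding act_add_poly act_smult
    by (simp add: monom_altdef act_X_power vec.scale_minus_left)
  ultimately show ?thesis
    by (intro exI[of _ "monom 1 i + smult (-1) (monom 1 j)"]) simp
next
  case True
  define f where "f = (\<lambda>i. (((*v) M) ^^ i) x)"
  have "card (f ` {..CARD('n)}) = CARD('n) + 1"
    using True by (simp add: card_image f_def)
  then have "vec.dependent (f ` {..CARD('n)})"
    using vec.dim_eq_card_independent[of "f ` {..CARD('n)}"] dim_subset_UNIV_cart_gen[of "f ` {..CARD('n)}"]
    by auto
  then obtain u where u: "\<exists>v\<in>f ` {..CARD('n)}. u v \<noteq> 0" "(\<Sum>v\<in>f ` {..CARD('n)}. u v *s v) = 0"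
    using vec.dependent_finite[of "f ` {..CARD('n)}"] by auto
  define p where "p = (\<Sum>i\<le>CARD('n). smult (u (f i)) ([:0,1:] ^ i))"
  have "act M p x = (\<Sum>i\<le>CARD('n). u (f i) *s f i)"
    by (simp add: p_def act_sum act_smult act_X_power f_def)
  also have "\<dots> = 0"
    using u(2) True by (simp add: sum.reindex f_def)
  finally have "act M p x = 0" .
  moreover obtain i where i: "i \<le> CARD('n)" "u (f i) \<noteq> 0"
    using u(1) by auto
  have "coeff p i = (\<Sum>j\<le>CARD('n). if j = i then u (f j) else 0)"
    unfolding p_def coeff_sum by (intro sum.cong refl) (auto simp flip: monom_altdef)
  then have "coeff p i \<noteq> 0" using i by simp
  then have "p \<noteq> 0" by auto
  ultimately show ?thesis by blast
qed

text \<open>Take \<open>p\<close> of least degree killing \<open>x\<close>. If \<open>z\<close> is a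
  root, the cofactor of \<open>X - z\<close> does not kill \<open>x\<close>, so it sends
  \<open>x\<close> to an eigenvector for \<open>z\<close>.\<close>

lemma ex_eigenvalue_annihilator:
  fixes A :: "real^'n^'n"
  shows "\<exists>p. p \<noteq> 0 \<and> act (cmatrix A) p x = 0 \<and> (\<forall>z. poly p z = 0 \<longrightarrow> z \<in> eigenvalues A)"
proof -
  let ?P = "\<lambda>p. p \<noteq> 0 \<and> act (cmatrix A) p x = 0"
  obtain p where p: "?P p" and least: "\<And>q. ?P q \<Longrightarrow> degree p \<le> degree q"
    using ex_has_least_nat[of ?P _ degree] ex_annihilating_poly[of "cmatrix A" x] by metis
  have "z \<in> eigenvalues A" if z: "poly p z = 0" for z
  proof -
    obtain h where h: "p = [:- z, 1:] * h"
      using z by (auto simp: poly_eq_0_iff_dvd dvd_def)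
    have "h \<noteq> 0" using p h by auto
    then have "degree h < degree p"
      unfolding h by (subst degree_mult_eq) auto
    then have ne: "act (cmatrix A) h x \<noteq> 0"
      using least[of h] \<open>h \<noteq> 0\<close> by auto
    have "act (cmatrix A) [:- z, 1:] (act (cmatrix A) h x) = 0"
      using p by (simp add: h act_mult[symmetric] del: mult_pCons_left act_pCons)
    then have "cmatrix A *v act (cmatrix A) h x = z *s act (cmatrix A) h x"
      by (simp add: vec.scale_minus_left add_eq_0_iff)
    then show ?thesis
      using ne by (auto simp: eigenvalues_def)
  qed
  with p show ?thesis by blast
qed

text \<open>The roots of an annihilator of a basis vector are eigenvalues, hence roots of
  \<open>q\<close>, so over the complex numbers the annihilator divides a power of \<open>q\<close>.
  The exponent \<open>N\<close> serves all basis vectors at once.\<close>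

lemma act_nilpotent:
  fixes A :: "real^'n^'n"
  assumes "\<And>z. z \<in> eigenvalues A \<Longrightarrow> poly q z = 0"
  shows "\<exists>N. \<forall>x. act (cmatrix A) (q ^ N) x = 0"
proof -
  obtain m where m: "\<And>i. m i \<noteq> 0" "\<And>i. act (cmatrix A) (m i) (axis i 1) = 0"
      "\<And>i z. poly (m i) z = 0 \<Longrightarrow> z \<in> eigenvalues A"
    using ex_eigenvalue_annihilator[of A "axis _ 1"] by metis
  define N where "N = (\<Sum>i\<in>UNIV. degree (m i))"
  have "act (cmatrix A) (q ^ N) (axis i 1) = 0" for i
  proof -
    have "m i dvd q ^ degree (m i)"
      using nullstellensatz_univariate[of "m i" q] m assms by blast
    also have "q ^ degree (m i) dvd q ^ N"
      unfolding N_def by (intro le_imp_power_dvd member_le_sum) auto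
    finally obtain r where "q ^ N = r * m i" by (metis dvdE mult.commute)
    then show ?thesis by (simp add: act_mult m)
  qed
  then have "act (cmatrix A) (q ^ N) x = 0" for x
    using act_basis_zero by blast
  then show ?thesis by blast
qed

lemma eigenvalue_iff_det:
  "z \<in> eigenvalues A \<longleftrightarrow> det (\<chi> i j. (if i = j then z else 0) - cmatrix A $ i $ j) = 0"
proof -
  let ?M = "\<chi> i j. (if i = j then z else 0) - cmatrix A $ i $ j"
  have M: "?M *v v = z *s v - cmatrix A *v v" for v
    by (auto simp: vec_eq_iff matrix_vector_mult_def left_diff_distrib sum_subtractf
        if_distrib[of "\<lambda>c. c * _"] cong: if_cong)
  have "det ?M = 0 \<longleftrightarrow> \<not> (\<forall>v. ?M *v v = 0 \<longrightarrow> v = 0)"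
    by (simp only: matrix_left_invertible_ker[symmetric] invertible_left_inverse[symmetric]
        invertible_det_nz) simp
  then show ?thesis
    unfolding M eigenvalues_def by auto
qed

text \<open>The product of annihilators of the basis vectors is nonzero and kills every vector;
  applied to eigenvectors, it shows that each eigenvalue is one of its roots.\<close>

lemma finite_eigenvalues: "finite (eigenvalues (A :: real^'n^'n))"
proof -
  obtain m where m: "\<And>i. m i \<noteq> 0" "\<And>i. act (cmatrix A) (m i) (axis i 1) = 0"
    using ex_eigenvalue_annihilator[of A "axis _ 1"] by metis
  define P where "P = (\<Prod>i\<in>UNIV. m i)"
  have "act (cmatrix A) P (axis i 1) = 0" for i
  proof -
    have "P = (\<Prod>j\<in>UNIV-{i}. m j) * m i"
      by (simp add: P_def prod.remove[of UNIV i] mult.commute)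
    then show ?thesis by (simp add: act_mult m)
  qed
  then have P: "act (cmatrix A) P x = 0" for x
    using act_basis_zero by blast
  have "eigenvalues A \<subseteq> {z. poly P z = 0}"
    using P by (auto simp: eigenvalues_def) (metis act_eigenvector vec.scale_eq_0_iff)
  moreover have "P \<noteq> 0" by (simp add: P_def m)
  ultimately show ?thesis
    using finite_subset Polynomial.poly_roots_finite by blast
qed

subsection \<open>A squarefree integer polynomial vanishing on the eigenvalues\<close>

text \<open>Covers \<open>of_int\<close>, \<open>of_rat\<close> and the evaluation of a mapped
  polynomial at a point. The last one moves evaluation inside the determinant that defines the
  characteristic polynomial.\<close>

locale comm_ring_map =
  fixes h :: "'a::comm_ring_1 \<Rightarrow> 'b::comm_ring_1"
  assumes add: "h (x + y) = h x + h y" and mult: "h (x * y) = h x * h y" and one: "h 1 = 1"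
begin

lemma zero: "h 0 = 0"
  using add[of 0 0] by simp

lemma minus: "h (- x) = - h x"
  using add[of x "- x"] by (simp add: zero add_eq_0_iff)

lemma sum: "h (sum f S) = (\<Sum>i\<in>S. h (f i))"
  by (induction S rule: infinite_finite_induct) (simp_all add: zero add)

lemma prod: "h (prod f S) = (\<Prod>i\<in>S. h (f i))"
  by (induction S rule: infinite_finite_induct) (simp_all add: one mult)

lemma det: "h (det M) = det (\<chi> i j. h (M $ i $ j))"
proof -
  have "h (of_int (sign p)) = of_int (sign p)" for p :: "'c \<Rightarrow> 'c"
    by (cases p rule: sign_cases) (simp_all add: one minus)
  then show ?thesis
    by (simp add: det_def sum mult prod)
qed

lemma map_poly_add: "map_poly h (p + q) = map_poly h p + map_poly h q"
  by (intro poly_eqI) (simp add: coeff_map_poly zero add)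

lemma map_poly_mult: "map_poly h (p * q) = map_poly h p * map_poly h q"
  by (intro poly_eqI) (simp add: coeff_map_poly coeff_mult zero sum mult)

lemma map_poly_smult: "map_poly h (smult c p) = smult (h c) (map_poly h p)"
  by (intro poly_eqI) (simp add: coeff_map_poly zero mult)

lemma comm_ring_map_eval: "comm_ring_map (\<lambda>p. poly (map_poly h p) z)"
  by unfold_locales (simp_all add: map_poly_add map_poly_mult one)

end

interpretation of_int: comm_ring_map of_int
  by unfold_locales simp_all

interpretation of_rat: comm_ring_map "of_rat :: rat \<Rightarrow> 'a::field_char_0"
  by unfold_locales (simp_all add: of_rat_add of_rat_mult)

lemma map_poly_of_rat_pderiv:
  "map_poly of_rat (pderiv p) = pderiv (map_poly (of_rat :: rat \<Rightarrow> 'a::field_char_0) p)"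
  by (intro poly_eqI) (simp add: coeff_map_poly coeff_pderiv of_rat_mult of_rat_add)

lemma ex_common_denominator:
  fixes p :: "rat poly"
  shows "\<exists>D q. D \<noteq> 0 \<and> map_poly of_int q = smult (of_int D) p"
proof (induction p)
  case 0
  show ?case by (intro exI[of _ 1] exI[of _ 0]) simp
next
  case (pCons a p)
  obtain D :: int and q :: "int poly" where Dq: "D \<noteq> 0" "map_poly of_int q = smult (of_int D) p"
    using pCons.IH by auto
  obtain n m where "quotient_of a = (n, m)"
    by (cases "quotient_of a") simp
  then have nm: "a = of_int n / of_int m" "m > 0"
    using quotient_of_div quotient_of_denom_pos by simp_all
  have "map_poly of_int (pCons (n * D) (smult m q)) = smult (of_int (m * D)) (pCons a p)"
    using nm Dq by (simp add: map_poly_pCons of_int.map_poly_smult)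
  then show ?case
    using nm Dq(1) by (intro exI[of _ "m * D"] exI conjI) auto
qed

lemma int_matrix_of_int:
  fixes A :: "real^'n^'n"
  assumes "int_matrix A"
  obtains a where "\<And>i j. A $ i $ j = of_int (a i j)"
proof
  fix i j
  have "A $ i $ j \<in> \<int>" using assms by (simp add: int_matrix_def)
  then show "A $ i $ j = of_int \<lfloor>A $ i $ j\<rfloor>" by simp
qed

text \<open>Divide the characteristic polynomial by its gcd with its derivative. Over the rationals
  the quotient stays rational, and clearing denominators makes it integral, so that
  \<open>q(A)\<close> preserves the integer vectors.\<close>

lemma ex_int_squarefree_eigenvalue_poly:
  fixes A :: "real^'n^'n"
  assumes "int_matrix A" "eigenvalues A \<noteq> {}"
  shows "\<exists>q. rsquarefree (map_poly of_int q :: complex poly) \<and>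
    (\<forall>z. poly (map_poly of_int q) z = 0 \<longleftrightarrow> z \<in> eigenvalues A)"
proof -
  obtain a where a: "\<And>i j. A $ i $ j = of_int (a i j)"
    using assms(1) int_matrix_of_int by blast
  \<comment> \<open>The characteristic polynomial: the entries are those of
    \<open>X I - A\<close>.\<close>
  define \<chi>A :: "rat poly" where "\<chi>A = det (\<chi> i j. [:- of_int (a i j), if i = j then 1 else 0:])"
  let ?C = "map_poly of_rat :: rat poly \<Rightarrow> complex poly"
  have char: "poly (?C \<chi>A) z = 0 \<longleftrightarrow> z \<in> eigenvalues A" for z
  proof -
    interpret comm_ring_map "\<lambda>p. poly (?C p) z"
      by (rule of_rat.comm_ring_map_eval)
    have "poly (?C \<chi>A) z = det (\<chi> i j. (if i = j then z else 0) - cmatrix A $ i $ j)"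
      unfolding \<chi>A_def det
      by (intro arg_cong[of _ _ det])
         (simp add: vec_eq_iff map_poly_pCons cmatrix_def a of_rat_minus)
    then show ?thesis by (simp add: eigenvalue_iff_det)
  qed
  \<comment> \<open>Some number is not an eigenvalue, so \<open>\<chi>A\<close> is nonzero; some
    number is one, so it is not constant. Hence its derivative does not vanish.\<close>
  obtain z where "z \<notin> eigenvalues A"
    using finite_eigenvalues[of A] infinite_UNIV_char_0[where 'a = complex] ex_new_if_finite by blast
  then have "?C \<chi>A \<noteq> 0" using char by force
  moreover obtain w where "w \<in> eigenvalues A" using assms(2) by blast
  ultimately have "pderiv (?C \<chi>A) \<noteq> 0"
    using char pderiv_iszero[of "?C \<chi>A"] by force
  define d where "d = gcd \<chi>A (pderiv \<chi>A)"
  have "d dvd \<chi>A" "d dvd pderiv \<chi>A" by (simp_all add: d_def)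
  then obtain q0 e where "\<chi>A = d * q0" "pderiv \<chi>A = d * e"
    unfolding dvd_def by blast
  then have q0: "\<chi>A = q0 * d" and e: "pderiv \<chi>A = e * d"
    by (simp_all only: mult.commute)
  \<comment> \<open>The Bezout identity is found over the rationals; its image over the complex
    numbers is what the squarefree decomposition asks for.\<close>
  obtain r s where "bezout_coefficients \<chi>A (pderiv \<chi>A) = (r, s)"
    by (cases "bezout_coefficients \<chi>A (pderiv \<chi>A)") simp
  then have d: "d = r * \<chi>A + s * pderiv \<chi>A"
    by (simp add: bezout_coefficients d_def)
  have "rsquarefree (?C q0) \<and> (\<forall>a. poly (?C q0) a = 0 \<longleftrightarrow> poly (?C \<chi>A) a = 0)"
  proof (rule poly_squarefree_decomp)
    show "pderiv (?C \<chi>A) \<noteq> 0" by fact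
    show "?C \<chi>A = ?C q0 * ?C d"
      using q0 of_rat.map_poly_mult by metis
    show "pderiv (?C \<chi>A) = ?C e * ?C d"
      using e of_rat.map_poly_mult map_poly_of_rat_pderiv by metis
    show "?C d = ?C r * ?C \<chi>A + ?C s * pderiv (?C \<chi>A)"
      using d of_rat.map_poly_mult of_rat.map_poly_add map_poly_of_rat_pderiv by metis
  qed
  note sf = this
  obtain D q where D: "D \<noteq> 0" "map_poly of_int q = smult (of_int D) q0"
    using ex_common_denominator by blast
  have "(map_poly of_int q :: complex poly) = ?C (map_poly of_int q)"
    by (intro poly_eqI) (simp add: coeff_map_poly)
  then have q: "(map_poly of_int q :: complex poly) = smult (of_int D) (?C q0)"
    by (simp add: D of_rat.map_poly_smult)
  \<comment> \<open>Scaling by the nonzero \<open>D\<close> changes neither roots nor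
    orders.\<close>
  have "rsquarefree (map_poly of_int q :: complex poly)"
    unfolding q using sf D(1) by (simp add: rsquarefree_def order_smult)
  moreover have "\<forall>z. poly (map_poly of_int q) z = 0 \<longleftrightarrow> z \<in> eigenvalues A"
    unfolding q using sf char D(1) by simp
  ultimately show ?thesis by blast
qed

subsection \<open>Density of the preimages of the integer lattice\<close>

text \<open>Taking real parts commutes with real matrices and does not increase norms, so it
  projects a complex decomposition of a real vector to a real one with the same bounds.\<close>

definition re_vec :: "complex^'n \<Rightarrow> real^'n" where
  "re_vec y = (\<chi> i. Re (y $ i))"

definition of_real_vec :: "real^'n \<Rightarrow> complex^'n" where
  "of_real_vec x = (\<chi> i. of_real (x $ i))"

lemma re_vec_of_real_vec [simp]: "re_vec (of_real_vec x) = x"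
  by (simp add: re_vec_def of_real_vec_def vec_eq_iff)

lemma re_vec_zero [simp]: "re_vec 0 = 0"
  by (simp add: re_vec_def vec_eq_iff)

lemma re_vec_add: "re_vec (x + y) = re_vec x + re_vec y"
  by (simp add: re_vec_def vec_eq_iff)

lemma re_vec_scale: "re_vec (of_real c *s x) = c *s re_vec x"
  by (simp add: re_vec_def vec_eq_iff)

lemma re_vec_matrix: "re_vec (cmatrix A *v y) = A *v re_vec y"
  by (simp add: re_vec_def vec_eq_iff matrix_vector_mult_def cmatrix_def)

lemma re_vec_matrix_funpow: "re_vec (((*v) (cmatrix A) ^^ n) y) = ((*v) A ^^ n) (re_vec y)"
  by (induction n) (simp_all add: re_vec_matrix)

lemma re_vec_act: "re_vec (act (cmatrix A) (map_poly of_int q) y) = act A (map_poly of_int q) (re_vec y)"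
proof (induction q)
  case (pCons a q)
  have "re_vec (of_int a *s y) = of_int a *s re_vec y"
    using re_vec_scale[of "of_int a" y] by simp
  with pCons show ?case
    by (simp add: map_poly_pCons re_vec_add re_vec_matrix)
qed simp

lemma norm_re_vec_le: "norm (re_vec y) \<le> norm y"
  unfolding norm_vec_def by (intro L2_set_mono) (simp_all add: re_vec_def abs_Re_le_cmod)

lemma norm_of_real_vec [simp]: "norm (of_real_vec x) = norm x"
  unfolding norm_vec_def by (intro L2_set_cong) (simp_all add: of_real_vec_def)

text \<open>Linear maps in finite dimension are bounded. The type covers both the complex
  interpolation polynomials and the powers of the real matrix \<open>q(A)\<close>.\<close>

lemma ex_act_bound:
  fixes M :: "'a::{real_normed_field, euclidean_space}^'n^'n"
  shows "\<exists>K\<ge>0. \<forall>y. norm (act M p y) \<le> K * norm y"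
proof -
  have "linear (act M p)"
  proof (rule linearI)
    show "act M p (c *\<^sub>R y) = c *\<^sub>R act M p y" for c y
    proof -
      have "c *\<^sub>R v = of_real c *s v" for v :: "'a^'n"
        unfolding vec_eq_iff vector_scaleR_component vector_smult_component
        by (simp add: scaleR_conv_of_real)
      then show ?thesis by (simp only: act_scale)
    qed
  qed (rule act_add)
  then have "bounded_linear (act M p)"
    by (simp add: linear_conv_bounded_linear)
  then show ?thesis
    using bounded_linear.nonneg_bounded by (metis mult.commute)
qed

lemma int_vec_add: "int_vec x \<Longrightarrow> int_vec y \<Longrightarrow> int_vec (x + y)"
  by (simp add: int_vec_def)

lemma int_vec_matrix: "int_matrix A \<Longrightarrow> int_vec x \<Longrightarrow> int_vec (A *v x)"
  by (auto simp: int_vec_def int_matrix_def matrix_vector_mult_def intro!: Ints_sum Ints_mult)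

lemma int_vec_act: "int_matrix A \<Longrightarrow> int_vec x \<Longrightarrow> int_vec (act A (map_poly of_int q) x)"
proof (induction q)
  case 0
  show ?case by (simp add: int_vec_def)
next
  case (pCons a q)
  then have "int_vec (of_int a *s x)"
    by (auto simp: int_vec_def)
  with pCons show ?case
    by (simp add: map_poly_pCons int_vec_add int_vec_matrix)
qed

text \<open>Roots are split off one at a time; being distinct, those already split off leave a
  product that does not vanish at the next one.\<close>

lemma prod_linear_dvd:
  fixes p :: "'a::idom poly"
  assumes "finite E" "\<And>z. z \<in> E \<Longrightarrow> poly p z = 0"
  shows "(\<Prod>z\<in>E. [:- z, 1:]) dvd p"
  using assms
proof (induction E)
  case (insert z E)
  then obtain r where r: "p = (\<Prod>z\<in>E. [:- z, 1:]) * r"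
    by (auto simp: dvd_def)
  have "poly (\<Prod>w\<in>E. [:- w, 1:]) z \<noteq> 0"
    using insert.hyps by (auto simp: poly_prod)
  then have "poly r z = 0"
    using insert.prems[of z] r by auto
  then obtain s where "r = [:- z, 1:] * s"
    by (auto simp: poly_eq_0_iff_dvd dvd_def)
  then have "p = (\<Prod>z\<in>insert z E. [:- z, 1:]) * s"
    using r insert.hyps by (simp add: mult_ac del: mult_pCons_left mult_pCons_right)
  then show ?case by (metis dvdI)
qed simp

text \<open>By Lagrange interpolation on the eigenvalues, \<open>x\<^sup>-\<^sup>n\<close> agrees modulo \<open>q\<close> with a polynomial whose
  coefficients are \<open>O(lam\<^sup>-\<^sup>n)\<close>; the interpolation is complex, so the real part is taken at the end.\<close>

lemma split_modulo_squarefree: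
  fixes A :: "real^'n^'n"
  assumes sf: "rsquarefree (map_poly of_int q :: complex poly)"
    and roots: "\<And>z. poly (map_poly of_int q) z = 0 \<longleftrightarrow> z \<in> eigenvalues A"
    and lam: "\<And>z. z \<in> eigenvalues A \<Longrightarrow> lam \<le> cmod z" "lam > 0"
  shows "\<exists>K\<ge>0. \<forall>n u. \<exists>s t. u = ((*v) A ^^ n) s + act A (map_poly of_int q) t \<and>
           norm s \<le> K * norm u / lam ^ n"
proof -
  define E where "E = eigenvalues A"
  define Q where "Q = (map_poly of_int q :: complex poly)"
  have fin: "finite E" by (simp add: E_def finite_eigenvalues)
  have E0: "z \<noteq> 0" if "z \<in> E" for z
    using lam(1)[of z] lam(2) that by (auto simp: E_def)
  \<comment> \<open>Lagrange basis for the nodes \<open>E\<close>. It does not depend on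
    \<open>n\<close>, so neither do the bounds \<open>K z\<close> below.\<close>
  define L where "L z = (\<Prod>w\<in>E - {z}. smult (inverse (z - w)) [:- w, 1:])" for z
  have L: "poly (L z) w = (if w = z then 1 else 0)" if "z \<in> E" "w \<in> E" for z w
  proof -
    have "poly (L z) w = (\<Prod>x\<in>E - {z}. (w - x) / (z - x))"
      by (simp add: L_def poly_prod divide_inverse algebra_simps)
    moreover have "\<dots> = 0" if "w \<noteq> z"
      using that \<open>w \<in> E\<close> fin by (intro prod_zero) auto
    moreover have "(\<Prod>x\<in>E - {z}. (z - x) / (z - x)) = 1"
      by (intro prod.neutral) auto
    ultimately show ?thesis by auto
  qed
  \<comment> \<open>\<open>r n\<close> takes the value \<open>1 / z^n\<close> at each
    \<open>z\<close> in \<open>E\<close>, which makes it an inverse of \<open>X^n\<close> modulo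
    \<open>Q\<close>.\<close>
  define r where "r n = (\<Sum>z\<in>E. smult (inverse z ^ n) (L z))" for n
  \<comment> \<open>By squarefreeness \<open>Q\<close> is a constant times distinct linear factors,
    so vanishing on \<open>E\<close> suffices for divisibility by \<open>Q\<close>.\<close>
  have "Q = smult (lead_coeff Q) (\<Prod>z\<in>E. [:- z, 1:])"
    using complex_poly_decompose_rsquarefree[OF sf] roots by (simp add: Q_def E_def)
  moreover have "lead_coeff Q \<noteq> 0"
    using sf by (simp add: Q_def rsquarefree_def)
  ultimately have Qdvd: "Q dvd p" if "\<And>z. z \<in> E \<Longrightarrow> poly p z = 0" for p
    using prod_linear_dvd[OF fin that] by (metis smult_dvd_iff)
  have "\<exists>h. 1 = [:0, 1:] ^ n * r n + Q * h" for n
  proof -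
    have "poly (1 - [:0, 1:] ^ n * r n) w = 0" if "w \<in> E" for w
    proof -
      have "poly (r n) w = (\<Sum>z\<in>E. if z = w then inverse z ^ n else 0)"
        unfolding r_def poly_sum using that by (intro sum.cong) (auto simp: L)
      also have "\<dots> = inverse w ^ n" using that fin by simp
      finally show ?thesis using E0[OF that] by (simp add: power_inverse)
    qed
    then obtain h where "1 - [:0, 1:] ^ n * r n = Q * h"
      using Qdvd by (meson dvdE)
    then show ?thesis by (metis add.commute diff_add_cancel)
  qed
  then obtain h where h: "\<And>n. 1 = [:0, 1:] ^ n * r n + Q * h n" by metis
  obtain K where K: "\<And>z. K z \<ge> 0" "\<And>z y. norm (act (cmatrix A) (L z) y) \<le> K z * norm y"
    using ex_act_bound[of "cmatrix A" "L _"] by metis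
  have r_bound: "norm (act (cmatrix A) (r n) y) \<le> sum K E * norm y / lam ^ n" for n y
  proof -
    have "norm (act (cmatrix A) (r n) y) \<le> (\<Sum>z\<in>E. norm (inverse z ^ n *s act (cmatrix A) (L z) y))"
      unfolding r_def act_sum act_smult by (rule norm_sum)
    also have "\<dots> \<le> (\<Sum>z\<in>E. K z * norm y / lam ^ n)"
    proof (rule sum_mono)
      fix z assume z: "z \<in> E"
      have "norm (c *s v) = cmod c * norm v" for c and v :: "complex^'n"
        by (simp add: norm_vec_def norm_mult L2_set_right_distrib)
      then have "norm (inverse z ^ n *s act (cmatrix A) (L z) y)
          = norm (act (cmatrix A) (L z) y) / cmod z ^ n"
        by (simp add: norm_power norm_inverse power_inverse divide_inverse)
      also have "\<dots> \<le> K z * norm y / lam ^ n"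
        using z lam K E0[OF z] by (intro frac_le power_mono) (auto simp: E_def)
      finally show "norm (inverse z ^ n *s act (cmatrix A) (L z) y) \<le> K z * norm y / lam ^ n" .
    qed
    also have "\<dots> = sum K E * norm y / lam ^ n"
      by (simp add: sum_distrib_right sum_divide_distrib)
    finally show ?thesis .
  qed
  show ?thesis
  proof (intro exI[of _ "sum K E"] conjI allI)
    show "sum K E \<ge> 0" by (simp add: K sum_nonneg)
    fix n and u :: "real^'n"
    let ?u = "of_real_vec u"
    let ?s = "act (cmatrix A) (r n) ?u"
    have "act (cmatrix A) 1 ?u = ((*v) (cmatrix A) ^^ n) ?s + act (cmatrix A) Q (act (cmatrix A) (h n) ?u)"
      by (subst h[of n]) (simp add: act_add_poly act_mult act_X_power)
    then have "re_vec ?u = re_vec (((*v) (cmatrix A) ^^ n) ?s + act (cmatrix A) Q (act (cmatrix A) (h n) ?u))"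
      by simp
    then have "u = ((*v) A ^^ n) (re_vec ?s) + act A (map_poly of_int q) (re_vec (act (cmatrix A) (h n) ?u))"
      by (simp add: re_vec_add re_vec_matrix_funpow Q_def re_vec_act)
    moreover have "norm (re_vec ?s) \<le> sum K E * norm u / lam ^ n"
      using norm_re_vec_le[of ?s] r_bound[of n ?u] by simp
    ultimately show "\<exists>s t. u = ((*v) A ^^ n) s + act A (map_poly of_int q) t \<and>
           norm s \<le> sum K E * norm u / lam ^ n" by blast
  qed
qed

lemma act_funpow_commute: "act A p (((*v) A ^^ n) x) = ((*v) A ^^ n) (act A p x)"
  by (induction n) (simp_all add: act_matrix_commute)

lemma matrix_funpow_add: "((*v) (A :: real^'n^'n) ^^ n) (x + y) = ((*v) A ^^ n) x + ((*v) A ^^ n) y"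
  by (induction n) (simp_all add: matrix_vector_right_distrib)

text \<open>The bound carries no polynomial factor in \<open>n\<close> even when \<open>A\<close> has nontrivial Jordan blocks. Descending
  along the images of \<open>q(A)\<^sup>j\<close>, each successive quotient is semisimple, and \<open>q(A)\<^sup>j\<close> maps integer
  vectors to integer vectors.\<close>

lemma int_approximation:
  fixes A :: "real^'n^'n"
  assumes A: "int_matrix A" and ne: "eigenvalues A \<noteq> {}"
    and lam: "\<And>z. z \<in> eigenvalues A \<Longrightarrow> lam \<le> cmod z" "lam > 0"
  shows "\<exists>R. \<forall>n y. \<exists>k s. int_vec k \<and> y = k + ((*v) A ^^ n) s \<and> norm s \<le> R / lam ^ n"
proof -
  obtain q where sf: "rsquarefree (map_poly of_int q :: complex poly)"
    and roots: "\<And>z. poly (map_poly of_int q) z = 0 \<longleftrightarrow> z \<in> eigenvalues A"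
    using ex_int_squarefree_eigenvalue_poly[OF A ne] by blast
  let ?q = "map_poly of_int q :: real poly"
  let ?B = "\<lambda>j. act A ?q ^^ j"
  obtain K where K: "K \<ge> 0" "\<And>n u. \<exists>s t. u = ((*v) A ^^ n) s + act A ?q t \<and>
           norm s \<le> K * norm u / lam ^ n"
    using split_modulo_squarefree[OF sf roots lam] by blast
  obtain N where N: "\<And>x. act (cmatrix A) ((map_poly of_int q) ^ N) x = 0"
    using act_nilpotent[of A "map_poly of_int q"] roots by blast
  have "re_vec ((act (cmatrix A) (map_poly of_int q) ^^ j) y) = ?B j (re_vec y)" for j y
    by (induction j) (simp_all add: re_vec_act)
  then have BN: "?B N x = 0" for x
    using N[of "of_real_vec x"] by (metis act_power re_vec_of_real_vec re_vec_zero)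
  have B_add: "?B j (x + y) = ?B j x + ?B j y" for j x y
    by (induction j) (simp_all add: act_add)
  have B_comm: "?B j (((*v) A ^^ n) x) = ((*v) A ^^ n) (?B j x)" for j n x
    by (induction j) (simp_all add: act_funpow_commute)
  have B_int: "int_vec x \<Longrightarrow> int_vec (?B j x)" for j x
    by (induction j) (simp_all add: int_vec_act[OF A])
  \<comment> \<open>Downward induction: \<open>?B N\<close> is zero, and \<open>?B 0\<close> is the
    identity.\<close>
  have "j \<le> N \<Longrightarrow> \<exists>R. \<forall>n z. \<exists>k s. int_vec k \<and> ?B j z = k + ((*v) A ^^ n) s \<and> norm s \<le> R / lam ^ n" for j
  proof (induction j rule: inc_induct)
    case base
    have "((*v) A ^^ n) 0 = 0" for n by (induction n) simp_all
    then have "\<forall>n z. int_vec 0 \<and> ?B N z = 0 + ((*v) A ^^ n) 0 \<and> norm (0::real^'n) \<le> 0 / lam ^ n"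
      by (simp add: BN int_vec_def)
    then show ?case by blast
  next
    case (step j)
    then obtain R where R: "\<And>n z. \<exists>k s. int_vec k \<and> ?B (Suc j) z = k + ((*v) A ^^ n) s \<and> norm s \<le> R / lam ^ n"
      by blast
    obtain c where c: "c \<ge> 0" "\<And>y. norm (?B j y) \<le> c * norm y"
      using ex_act_bound[of A "?q ^ j"] by (auto simp: act_power)
    \<comment> \<open>\<open>c\<close> bounds \<open>q(A)^j\<close>, \<open>K * CARD('n)\<close>
      bounds \<open>s0\<close> up to the factor \<open>1 / lam ^ n\<close>, and \<open>R\<close>
      comes from level \<open>j + 1\<close>.\<close>
    define R' where "R' = c * (K * real CARD('n)) + R"
    have "\<exists>k s. int_vec k \<and> ?B j z = k + ((*v) A ^^ n) s \<and> norm s \<le> R' / lam ^ n" for n z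
    proof -
      \<comment> \<open>Removing the integer part first keeps the vector to be split bounded;
        \<open>?B j k0\<close> is again integral.\<close>
      define k0 :: "real^'n" where "k0 = (\<chi> i. of_int \<lfloor>z $ i\<rfloor>)"
      define u where "u = z - k0"
      have k0: "int_vec k0" by (simp add: k0_def int_vec_def)
      have "norm u \<le> (\<Sum>i\<in>UNIV. \<bar>u $ i\<bar>)" by (rule norm_le_l1_cart)
      also have "\<dots> \<le> (\<Sum>i\<in>(UNIV :: 'n set). 1)"
        by (intro sum_mono) (simp add: u_def k0_def, linarith)
      finally have u: "norm u \<le> real CARD('n)" by simp
      obtain s0 t where st: "u = ((*v) A ^^ n) s0 + act A ?q t" "norm s0 \<le> K * norm u / lam ^ n"
        using K(2) by blast
      obtain k2 s2 where 2: "int_vec k2" "?B (Suc j) t = k2 + ((*v) A ^^ n) s2" "norm s2 \<le> R / lam ^ n"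
        using R by blast
      have "?B j z = ?B j k0 + ?B j u"
        by (simp add: u_def flip: B_add)
      \<comment> \<open>The remainder \<open>act A ?q t\<close> supplies one more factor
        \<open>q(A)\<close>, which hands it to the induction hypothesis.\<close>
      also have "?B j u = ((*v) A ^^ n) (?B j s0) + ?B (Suc j) t"
        by (subst st) (simp add: B_add B_comm funpow_swap1)
      finally have "?B j z = (?B j k0 + k2) + ((*v) A ^^ n) (?B j s0 + s2)"
        unfolding 2(2) by (simp add: matrix_funpow_add algebra_simps)
      moreover have "int_vec (?B j k0 + k2)"
        using B_int k0 2 int_vec_add by blast
      moreover have "norm (?B j s0 + s2) \<le> R' / lam ^ n"
      proof -
        have "norm (?B j s0) \<le> c * (K * real CARD('n) / lam ^ n)"
        proof (rule order_trans[OF c(2)], rule mult_left_mono[OF _ c(1)], rule order_trans[OF st(2)])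
          show "K * norm u / lam ^ n \<le> K * real CARD('n) / lam ^ n"
            using u K lam by (intro divide_right_mono mult_left_mono) auto
        qed
        then show ?thesis
          using 2(3) norm_triangle_ineq[of "?B j s0" s2] by (simp add: R'_def add_divide_distrib)
      qed
      ultimately show ?thesis by blast
    qed
    then show ?case by blast
  qed
  from this[of 0] show ?thesis by simp
qed

subsection \<open>Invariance of Lebesgue measure on the torus\<close>

text \<open>Half-open, so that it contains exactly one integer translate of every point; the closed
  cube of \<open>torus_mu\<close> differs from it by a null set.\<close>

definition unit_cube :: "(real^'n) set" where
  "unit_cube = {x. \<forall>i. 0 \<le> x $ i \<and> x $ i < 1}"

definition frac_vec :: "real^'n \<Rightarrow> real^'n" where
  "frac_vec x = (\<chi> i. frac (x $ i))"

definition floor_vec :: "real^'n \<Rightarrow> real^'n" where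
  "floor_vec x = (\<chi> i. of_int \<lfloor>x $ i\<rfloor>)"

lemma frac_floor_vec: "frac_vec x = x - floor_vec x"
  by (simp add: frac_vec_def floor_vec_def vec_eq_iff frac_def)

lemma int_vec_floor_vec: "int_vec (floor_vec x)"
  by (simp add: int_vec_def floor_vec_def)

lemma int_vec_minus: "int_vec k \<Longrightarrow> int_vec (- k)"
  by (simp add: int_vec_def)

lemma periodic_fun_frac: "periodic_fun f \<Longrightarrow> f (frac_vec x) = f x"
  unfolding periodic_fun_def frac_floor_vec
  by (metis int_vec_floor_vec int_vec_minus uminus_add_conv_diff add.commute)

lemma frac_vec_unit_cube: "x \<in> unit_cube \<Longrightarrow> frac_vec x = x"
  by (simp add: unit_cube_def frac_vec_def vec_eq_iff frac_eq)

lemma frac_vec_periodic: "periodic_fun (frac_vec :: real^'n \<Rightarrow> real^'n)"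
  by (auto simp: periodic_fun_def frac_vec_def vec_eq_iff int_vec_def frac_def Ints_def)

text \<open>Coordinatewise this is the uniqueness of the floor. It makes the integer translates of
  the cube a partition of the space.\<close>

lemma unit_cube_add_int_vec:
  assumes "int_vec k"
  shows "y + k \<in> unit_cube \<longleftrightarrow> k = - floor_vec y"
proof -
  have "0 \<le> y $ i + k $ i \<and> y $ i + k $ i < 1 \<longleftrightarrow> k $ i = - of_int \<lfloor>y $ i\<rfloor>" for i
  proof -
    obtain m where m: "k $ i = of_int m"
      using assms by (auto simp: int_vec_def elim: Ints_cases)
    have "0 \<le> y $ i + of_int m \<and> y $ i + of_int m < 1 \<longleftrightarrow> m = - \<lfloor>y $ i\<rfloor>"
      by linarith
    then show ?thesis
      unfolding m of_int_minus[symmetric] of_int_eq_iff .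
  qed
  then show ?thesis
    by (auto simp: unit_cube_def floor_vec_def vec_eq_iff)
qed

lemma frac_vec_measurable [measurable]: "(frac_vec :: real^'n \<Rightarrow> real^'n) \<in> borel_measurable borel"
proof (subst borel_measurable_euclidean_space, rule ballI)
  fix b :: "real^'n" assume "b \<in> Basis"
  then obtain i where "b = axis i 1"
    by (auto simp: Basis_vec_def)
  then have "(\<lambda>x. frac_vec x \<bullet> b) = (\<lambda>x. x \<bullet> b - of_int \<lfloor>x \<bullet> b\<rfloor>)"
    by (simp add: frac_vec_def inner_axis frac_def)
  also have "\<dots> \<in> borel_measurable borel"
    by measurable
  finally show "(\<lambda>x. frac_vec x \<bullet> b) \<in> borel_measurable borel" .
qed

lemma unit_cube_borel [measurable]: "(unit_cube :: (real^'n) set) \<in> sets borel"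
proof -
  have "unit_cube = {x :: real^'n. frac_vec x = x}"
    by (auto simp: unit_cube_def frac_vec_def vec_eq_iff frac_eq)
  moreover have "{x :: real^'n \<in> space borel. frac_vec x = x} \<in> sets borel"
    by measurable
  ultimately show ?thesis by simp
qed

lemma One_vec: "(One :: real^'n) = (\<chi> i. 1)"
proof -
  have "(One :: real^'n) $ i = 1" for i
    unfolding cart_eq_inner_axis by (rule inner_sum_Basis) (simp add: axis_in_Basis_iff)
  then show ?thesis by (simp add: vec_eq_iff)
qed

lemma unit_cube_subset_cbox: "unit_cube \<subseteq> cbox 0 (One :: real^'n)"
  unfolding One_vec by (auto simp: unit_cube_def mem_box_cart less_imp_le)

lemma box_subset_unit_cube: "box 0 (One :: real^'n) \<subseteq> unit_cube"
  unfolding One_vec by (auto simp: unit_cube_def mem_box_cart less_imp_le)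

text \<open>The cube lies between the open and the closed unit box, both of volume 1.\<close>

lemma emeasure_unit_cube: "emeasure lborel (unit_cube :: (real^'n) set) = 1"
proof (rule antisym)
  have le: "0 \<bullet> b \<le> One \<bullet> b" if "b \<in> Basis" for b :: "real^'n"
    by (simp only: inner_zero_left inner_sum_Basis[OF that] zero_le_one)
  have prod: "(\<Prod>b\<in>Basis. (One - 0 :: real^'n) \<bullet> b) = 1"
    by (rule prod.neutral) (auto simp only: diff_zero inner_sum_Basis)
  have "emeasure lborel (unit_cube :: (real^'n) set) \<le> emeasure lborel (cbox 0 (One :: real^'n))"
    by (rule emeasure_mono[OF unit_cube_subset_cbox]) simp
  also have "\<dots> = 1"
    by (subst emeasure_lborel_cbox[OF le]) (simp_all only: prod ennreal_1)
  finally show "emeasure lborel (unit_cube :: (real^'n) set) \<le> 1" .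
  have "1 = emeasure lborel (box 0 (One :: real^'n))"
    by (subst emeasure_lborel_box[OF le]) (simp_all only: prod ennreal_1)
  also have "\<dots> \<le> emeasure lborel (unit_cube :: (real^'n) set)"
    by (rule emeasure_mono[OF box_subset_unit_cube]) simp
  finally show "1 \<le> emeasure lborel (unit_cube :: (real^'n) set)" .
qed

lemma AE_cbox_unit_cube: "AE x in lebesgue. x \<in> cbox 0 (One :: real^'n) \<longleftrightarrow> x \<in> unit_cube"
proof -
  have "cbox 0 (One :: real^'n) - box 0 One \<in> null_sets lebesgue"
    using negligible_frontier_interval negligible_iff_null_sets by blast
  then have "AE x in lebesgue. x \<notin> cbox 0 (One :: real^'n) - box 0 One"
    by (rule AE_not_in)
  then show ?thesis
    by eventually_elim (use unit_cube_subset_cbox box_subset_unit_cube in blast)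
qed

text \<open>\<open>cube_mu\<close> is \<open>torus_mu\<close> on Borel sets, spread over the whole space: unlike \<open>torus_mu\<close> it is not
  complete, so that Borel functions on products are measurable for Fubini's theorem.\<close>

definition cube_mu :: "(real^'n) measure" where
  "cube_mu = density lborel (\<lambda>x. ennreal (indicator unit_cube x))"

lemma sets_cube_mu [measurable_cong, simp]: "sets cube_mu = sets borel"
  by (simp add: cube_mu_def)

lemma space_cube_mu [simp]: "space cube_mu = UNIV"
  by (simp add: cube_mu_def)

lemma nn_integral_cube_mu:
  "f \<in> borel_measurable borel \<Longrightarrow> nn_integral cube_mu f = (\<integral>\<^sup>+x. indicator unit_cube x * f x \<partial>lborel)"
  unfolding cube_mu_def by (subst nn_integral_density) (auto simp: ennreal_indicator)

lemma AE_cube_mu: "AE x in cube_mu. x \<in> unit_cube"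
  unfolding cube_mu_def by (subst AE_density) (auto simp: indicator_def)

lemma emeasure_cube_mu: "emeasure cube_mu UNIV = 1"
  by (simp add: cube_mu_def emeasure_density emeasure_unit_cube ennreal_indicator)

interpretation cube_mu: finite_measure cube_mu
  by (rule finite_measureI) (simp add: emeasure_cube_mu)

lemma measure_cube_mu: "measure cube_mu UNIV = 1"
  by (simp add: measure_def emeasure_cube_mu)

text \<open>Both sides integrate a function times the indicator of a cube; these products agree
  almost everywhere, and completion does not affect Borel functions. Torus integrals can thus be
  computed with a Borel representative.\<close>

lemma torus_mu_cube_mu:
  fixes f g :: "real^'n \<Rightarrow> 'b::euclidean_space"
  assumes ae: "AE x in lebesgue. f x = g x" and g [measurable]: "g \<in> borel_measurable borel"
  shows "integrable torus_mu f \<longleftrightarrow> integrable cube_mu g"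
    and "integral\<^sup>L torus_mu f = integral\<^sup>L cube_mu g"
proof -
  have gl: "g \<in> borel_measurable lebesgue"
    by (rule measurable_completion) simp
  have f: "f \<in> borel_measurable lebesgue"
    by (rule borel_measurable_AE[OF gl]) (use ae in eventually_elim, simp)
  have ind: "(\<lambda>x. indicator (cbox 0 One) x *\<^sub>R f x) \<in> borel_measurable lebesgue"
    using f by (intro borel_measurable_scaleR borel_measurable_indicator) auto
  have ind': "(\<lambda>x. indicator unit_cube x *\<^sub>R g x) \<in> borel_measurable lebesgue"
    by (rule measurable_completion) simp
  have eq: "AE x in lebesgue. indicator (cbox 0 One) x *\<^sub>R f x = indicator unit_cube x *\<^sub>R g x"
    using ae AE_cbox_unit_cube by eventually_elim (auto simp: indicator_def)
  have "integrable torus_mu f \<longleftrightarrow> integrable lebesgue (\<lambda>x. indicator (cbox 0 One) x *\<^sub>R f x)"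
    unfolding torus_mu_def by (subst integrable_restrict_space) auto
  also have "\<dots> \<longleftrightarrow> integrable lebesgue (\<lambda>x. indicator unit_cube x *\<^sub>R g x)"
    by (rule integrable_cong_AE[OF ind ind' eq])
  also have "\<dots> \<longleftrightarrow> integrable lborel (\<lambda>x. indicator unit_cube x *\<^sub>R g x)"
    by (rule integrable_completion) simp
  also have "\<dots> \<longleftrightarrow> integrable cube_mu g"
    unfolding cube_mu_def by (subst integrable_density) auto
  finally show "integrable torus_mu f \<longleftrightarrow> integrable cube_mu g" .
  have "integral\<^sup>L torus_mu f = integral\<^sup>L lebesgue (\<lambda>x. indicator (cbox 0 One) x *\<^sub>R f x)"
    unfolding torus_mu_def by (subst integral_restrict_space) auto
  also have "\<dots> = integral\<^sup>L lebesgue (\<lambda>x. indicator unit_cube x *\<^sub>R g x)"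
    by (rule integral_cong_AE[OF ind ind' eq])
  also have "\<dots> = integral\<^sup>L lborel (\<lambda>x. indicator unit_cube x *\<^sub>R g x)"
    by (rule integral_completion) simp
  also have "\<dots> = integral\<^sup>L cube_mu g"
    unfolding cube_mu_def by (subst integral_density) auto
  finally show "integral\<^sup>L torus_mu f = integral\<^sup>L cube_mu g" .
qed

section \<open>Integer translates of the cube and invariance under translations\<close>

lemma countable_int_vec: "countable {k :: real^'n. int_vec k}"
proof -
  have "{k :: real^'n. int_vec k} \<subseteq> range (\<lambda>m :: int^'n. \<chi> i. of_int (m $ i))"
  proof
    fix k :: "real^'n" assume "k \<in> {k. int_vec k}"
    then have "k = (\<chi> i. of_int ((\<chi> i. \<lfloor>k $ i\<rfloor>) $ i))"
      by (simp add: vec_eq_iff int_vec_def)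
    then show "k \<in> range (\<lambda>m :: int^'n. \<chi> i. of_int (m $ i))" by blast
  qed
  then show ?thesis
    by (rule countable_subset) simp
qed

text \<open>Together with countability this enumerates the lattice by the natural numbers without
  repetition, so that lattice sums become series.\<close>

lemma infinite_int_vec: "infinite {k :: real^'n. int_vec k}"
proof -
  have "inj (\<lambda>m::nat. (\<chi> i. of_nat m) :: real^'n)"
    by (auto simp: inj_def vec_eq_iff)
  moreover have "range (\<lambda>m::nat. (\<chi> i. of_nat m) :: real^'n) \<subseteq> {k. int_vec k}"
    by (auto simp: int_vec_def)
  ultimately show ?thesis
    using infinite_iff_countable_subset by blast
qed

lemma nn_integral_lborel_add:
  fixes c :: "'a::euclidean_space"
  assumes "f \<in> borel_measurable borel"
  shows "(\<integral>\<^sup>+x. f (x + c) \<partial>lborel) = (\<integral>\<^sup>+x. f x \<partial>lborel)"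
proof -
  have "(\<integral>\<^sup>+x. f x \<partial>lborel) = (\<integral>\<^sup>+x. f x \<partial>distr lborel borel ((+) c))"
    by (simp add: lborel_distr_plus)
  also have "\<dots> = (\<integral>\<^sup>+x. f (x + c) \<partial>lborel)"
    using assms by (subst nn_integral_distr) (auto simp: add.commute)
  finally show ?thesis ..
qed

text \<open>Cut the shifted cube by the integer translates of the cube and move the pieces back.\<close>

lemma nn_integral_cube_mu_translate:
  fixes h :: "real^'n \<Rightarrow> ennreal"
  assumes h [measurable]: "h \<in> borel_measurable borel" and per: "periodic_fun h"
  shows "(\<integral>\<^sup>+x. h (x + v) \<partial>cube_mu) = (\<integral>\<^sup>+x. h x \<partial>cube_mu)"
proof -
  let ?C = "indicator unit_cube :: real^'n \<Rightarrow> ennreal"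
  obtain e :: "nat \<Rightarrow> real^'n" where e: "bij_betw e UNIV {k. int_vec k}"
    using bij_betw_from_nat_into[OF countable_int_vec infinite_int_vec] by blast
  have int_e: "int_vec (e n)" for n
    using e by (auto simp: bij_betw_def)
  \<comment> \<open>In each sum exactly one term is 1, the one for the translate that moves
    \<open>y\<close> into the cube.\<close>
  have sum1: "(\<Sum>n. ?C (y + e n)) = 1" and sum2: "(\<Sum>n. ?C (y - e n)) = 1" for y
  proof -
    have *: "(\<Sum>n. if n = m then 1 else 0 :: ennreal) = 1" for m
      using sums_single[of m "\<lambda>_. 1 :: ennreal"] by (simp add: sums_iff)
    have ex: "\<exists>m. e m = k" if "int_vec k" for k
      using e that unfolding bij_betw_def by (metis (mono_tags, lifting) imageE mem_Collect_eq)
    have inj: "e n = e m \<longleftrightarrow> n = m" for n m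
      using e by (auto simp: bij_betw_def inj_on_def)
    obtain m where m: "e m = - floor_vec y"
      using ex int_vec_floor_vec int_vec_minus by metis
    have "?C (y + e n) = (if n = m then 1 else 0)" for n
      using unit_cube_add_int_vec[OF int_e[of n], of y] m inj[of n m] by (auto simp: indicator_def)
    then show "(\<Sum>n. ?C (y + e n)) = 1" by (simp add: *)
    obtain m' where m': "e m' = floor_vec y"
      using ex int_vec_floor_vec by metis
    have "?C (y - e n) = (if n = m' then 1 else 0)" for n
      using unit_cube_add_int_vec[OF int_vec_minus[OF int_e[of n]], of y] m' inj[of n m'] by (auto simp: indicator_def)
    then show "(\<Sum>n. ?C (y - e n)) = 1" by (simp add: *)
  qed
  have [measurable]: "?C \<in> borel_measurable borel" by simp
  have "(\<integral>\<^sup>+x. h (x + v) \<partial>cube_mu) = (\<integral>\<^sup>+x. ?C x * h (x + v) \<partial>lborel)"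
    by (rule nn_integral_cube_mu) simp
  also have "\<dots> = (\<integral>\<^sup>+x. ?C (x - v) * h x \<partial>lborel)"
    using nn_integral_lborel_add[of "\<lambda>x. ?C (x - v) * h x" v] by simp
  \<comment> \<open>The translates of the cube are inserted as a partition of unity.\<close>
  also have "\<dots> = (\<integral>\<^sup>+x. (\<Sum>n. ?C (x - v) * h x * ?C (x - e n)) \<partial>lborel)"
    by (simp add: sum2)
  also have "\<dots> = (\<Sum>n. \<integral>\<^sup>+x. ?C (x - v) * h x * ?C (x - e n) \<partial>lborel)"
    by (rule nn_integral_suminf) simp
  \<comment> \<open>The \<open>n\<close>-th piece is moved back by \<open>e n\<close>, under which
    \<open>h\<close> is invariant.\<close>
  also have "\<dots> = (\<Sum>n. \<integral>\<^sup>+x. ?C x * h x * ?C ((x - v) + e n) \<partial>lborel)"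
  proof (intro suminf_cong)
    fix n
    have "(\<integral>\<^sup>+x. ?C (x - v) * h x * ?C (x - e n) \<partial>lborel)
        = (\<integral>\<^sup>+x. ?C (x + e n - v) * h (x + e n) * ?C (x + e n - e n) \<partial>lborel)"
      by (rule nn_integral_lborel_add[symmetric]) simp
    also have "\<dots> = (\<integral>\<^sup>+x. ?C x * h x * ?C ((x - v) + e n) \<partial>lborel)"
      using per int_e by (intro nn_integral_cong) (simp add: periodic_fun_def algebra_simps)
    finally show "(\<integral>\<^sup>+x. ?C (x - v) * h x * ?C (x - e n) \<partial>lborel)
        = (\<integral>\<^sup>+x. ?C x * h x * ?C ((x - v) + e n) \<partial>lborel)" .
  qed
  also have "\<dots> = (\<integral>\<^sup>+x. (\<Sum>n. ?C x * h x * ?C ((x - v) + e n)) \<partial>lborel)"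
    by (rule nn_integral_suminf[symmetric]) simp
  \<comment> \<open>Now it is the translates of the shifted cube that sum to 1.\<close>
  also have "\<dots> = (\<integral>\<^sup>+x. ?C x * h x \<partial>lborel)"
    by (simp add: sum1)
  also have "\<dots> = (\<integral>\<^sup>+x. h x \<partial>cube_mu)"
    by (rule nn_integral_cube_mu[symmetric]) simp
  finally show ?thesis .
qed

text \<open>Isolates what the measure argument needs of \<open>A^n\<close>: such a map descends to a
  surjective endomorphism of the torus.\<close>

definition torus_endo :: "(real^'n \<Rightarrow> real^'n) \<Rightarrow> bool" where
  "torus_endo L \<longleftrightarrow> linear L \<and> surj L \<and> (\<forall>k. int_vec k \<longrightarrow> int_vec (L k))"

lemma linear_borel_measurable [measurable (raw)]: "linear (L :: real^'n \<Rightarrow> real^'m) \<Longrightarrow> L \<in> borel_measurable borel"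
  by (intro borel_measurable_continuous_onI linear_continuous_on) (simp add: linear_conv_bounded_linear)

lemma periodic_fun_endo: "torus_endo L \<Longrightarrow> periodic_fun h \<Longrightarrow> periodic_fun (\<lambda>x. h (L x))"
  by (auto simp: periodic_fun_def torus_endo_def linear_add)

text \<open>Translation invariance and surjectivity make the integral of \<open>h (L x + u)\<close> independent of \<open>u\<close>;
  average it over \<open>u\<close>.\<close>

lemma nn_integral_cube_mu_endo:
  fixes h :: "real^'n \<Rightarrow> ennreal"
  assumes h [measurable]: "h \<in> borel_measurable borel" and per: "periodic_fun h" and L: "torus_endo L"
  shows "(\<integral>\<^sup>+x. h (L x) \<partial>cube_mu) = (\<integral>\<^sup>+x. h x \<partial>cube_mu)"
proof -
  have [measurable]: "L \<in> borel_measurable borel" and lin: "linear L"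
    using L by (auto simp: torus_endo_def intro: linear_borel_measurable)
  have shift: "(\<integral>\<^sup>+x. h (L x + u) \<partial>cube_mu) = (\<integral>\<^sup>+x. h (L x) \<partial>cube_mu)" for u
  proof -
    \<comment> \<open>Surjectivity turns a shift by \<open>u\<close> after \<open>L\<close> into a
      translation by \<open>w\<close> before it.\<close>
    obtain w where w: "u = L w" using L by (auto simp: torus_endo_def surj_def)
    show ?thesis
      using nn_integral_cube_mu_translate[of "\<lambda>x. h (L x)" w] periodic_fun_endo[OF L per]
      by (simp add: w linear_add[OF lin])
  qed
  interpret P: pair_sigma_finite "cube_mu :: (real^'n) measure" "cube_mu :: (real^'n) measure" ..
  have "(\<integral>\<^sup>+x. h (L x) \<partial>cube_mu) = (\<integral>\<^sup>+u. (\<integral>\<^sup>+x. h (L x + u) \<partial>cube_mu) \<partial>cube_mu)"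
    by (simp add: shift emeasure_cube_mu)
  also have "\<dots> = (\<integral>\<^sup>+x. (\<integral>\<^sup>+u. h (L x + u) \<partial>cube_mu) \<partial>cube_mu)"
    by (rule P.Fubini') simp
  also have "\<dots> = (\<integral>\<^sup>+(x :: real^'n). (\<integral>\<^sup>+u. h u \<partial>cube_mu) \<partial>cube_mu)"
  proof -
    have "(\<integral>\<^sup>+u. h (L x + u) \<partial>cube_mu) = (\<integral>\<^sup>+u. h u \<partial>cube_mu)" for x
      using nn_integral_cube_mu_translate[OF h per, of "L x"] by (simp only: add.commute[of "L x"])
    then show ?thesis by simp
  qed
  also have "\<dots> = (\<integral>\<^sup>+u. h u \<partial>cube_mu)"
    by (simp add: emeasure_cube_mu)
  finally show ?thesis .
qed

text \<open>Invariance for nonnegative periodic functions says that \<open>\<phi>\<close> followed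
  by \<open>frac_vec\<close> pushes \<open>cube_mu\<close> to itself; Bochner integrals then
  transfer along this map. \<open>frac_vec\<close> brings points back to the cube that carries the
  measure.\<close>

lemma cube_mu_transfer:
  fixes h :: "real^'n \<Rightarrow> 'b::{banach, second_countable_topology}"
  assumes \<phi> [measurable]: "\<phi> \<in> borel_measurable borel"
    and inv: "\<And>h :: real^'n \<Rightarrow> ennreal. h \<in> borel_measurable borel \<Longrightarrow> periodic_fun h \<Longrightarrow>
      (\<integral>\<^sup>+x. h (\<phi> x) \<partial>cube_mu) = (\<integral>\<^sup>+x. h x \<partial>cube_mu)"
    and h [measurable]: "h \<in> borel_measurable borel" and per: "periodic_fun h"
  shows "integrable cube_mu (\<lambda>x. h (\<phi> x)) \<longleftrightarrow> integrable cube_mu h"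
    and "(\<integral>x. h (\<phi> x) \<partial>cube_mu) = (\<integral>x. h x \<partial>cube_mu)"
proof -
  have distr: "distr cube_mu borel (\<lambda>x. frac_vec (\<phi> x)) = cube_mu"
  proof (rule measure_eqI)
    fix B :: "(real^'n) set"
    assume "B \<in> sets (distr cube_mu borel (\<lambda>x. frac_vec (\<phi> x)))"
    then have B [measurable]: "B \<in> sets borel" by simp
    have "emeasure (distr cube_mu borel (\<lambda>x. frac_vec (\<phi> x))) B
        = (\<integral>\<^sup>+x. indicator B x \<partial>distr cube_mu borel (\<lambda>x. frac_vec (\<phi> x)))"
      by simp
    also have "\<dots> = (\<integral>\<^sup>+x. indicator B (frac_vec (\<phi> x)) \<partial>cube_mu)"
      by (rule nn_integral_distr) simp_all
    also have "\<dots> = (\<integral>\<^sup>+x. indicator B (frac_vec x) \<partial>cube_mu)"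
    proof (rule inv)
      show "periodic_fun (\<lambda>x. indicator B (frac_vec x) :: ennreal)"
        using frac_vec_periodic[where 'n = 'n] by (simp add: periodic_fun_def)
    qed simp
    also have "\<dots> = (\<integral>\<^sup>+x. indicator B x \<partial>cube_mu)"
      using AE_cube_mu by (intro nn_integral_cong_AE) (auto simp: frac_vec_unit_cube elim: eventually_mono)
    finally show "emeasure (distr cube_mu borel (\<lambda>x. frac_vec (\<phi> x))) B = emeasure cube_mu B"
      by simp
  qed simp
  have eq: "h (frac_vec (\<phi> x)) = h (\<phi> x)" for x
    by (rule periodic_fun_frac[OF per])
  show "integrable cube_mu (\<lambda>x. h (\<phi> x)) \<longleftrightarrow> integrable cube_mu h"
    using integrable_distr_eq[of "\<lambda>x. frac_vec (\<phi> x)" cube_mu borel h] by (simp add: distr eq)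
  show "(\<integral>x. h (\<phi> x) \<partial>cube_mu) = (\<integral>x. h x \<partial>cube_mu)"
    using integral_distr[of "\<lambda>x. frac_vec (\<phi> x)" cube_mu borel h] by (simp add: distr eq)
qed

lemma
  fixes h :: "real^'n \<Rightarrow> 'b::{banach, second_countable_topology}"
  assumes h: "h \<in> borel_measurable borel" "periodic_fun h"
  shows integrable_cube_mu_translate:
      "integrable cube_mu (\<lambda>x. h (x + v)) \<longleftrightarrow> integrable cube_mu h"
    and integral_cube_mu_translate: "(\<integral>x. h (x + v) \<partial>cube_mu) = (\<integral>x. h x \<partial>cube_mu)"
  by (rule cube_mu_transfer[where \<phi> = "\<lambda>x. x + v", OF _ nn_integral_cube_mu_translate h]; simp)+

lemma
  fixes h :: "real^'n \<Rightarrow> 'b::{banach, second_countable_topology}"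
  assumes h: "h \<in> borel_measurable borel" "periodic_fun h" and L: "torus_endo L"
  shows integrable_cube_mu_endo: "integrable cube_mu (\<lambda>x. h (L x)) \<longleftrightarrow> integrable cube_mu h"
    and integral_cube_mu_endo: "(\<integral>x. h (L x) \<partial>cube_mu) = (\<integral>x. h x \<partial>cube_mu)"
proof -
  have "L \<in> borel_measurable borel"
    using L by (auto simp: torus_endo_def intro: linear_borel_measurable)
  note * = cube_mu_transfer[where \<phi> = L, OF this nn_integral_cube_mu_endo h, OF _ _ L]
  show "integrable cube_mu (\<lambda>x. h (L x)) \<longleftrightarrow> integrable cube_mu h"
    by (rule *)
  show "(\<integral>x. h (L x) \<partial>cube_mu) = (\<integral>x. h x \<partial>cube_mu)"
    by (rule *)
qed

subsection \<open>Decay of correlations\<close>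

text \<open>Cauchy-Schwarz: the integral of the square of \<open>t * cmod (u x) - cmod (v x)\<close>
  is a nonnegative quadratic in \<open>t\<close>.\<close>

lemma
  fixes u v :: "'a \<Rightarrow> complex"
  assumes [measurable]: "u \<in> borel_measurable M" "v \<in> borel_measurable M"
    and u: "integrable M (\<lambda>x. (cmod (u x))\<^sup>2)" and v: "integrable M (\<lambda>x. (cmod (v x))\<^sup>2)"
  shows integrable_mult_L2: "integrable M (\<lambda>x. u x * v x)"
    and norm_integral_mult_le_L2:
      "cmod (\<integral>x. u x * v x \<partial>M) \<le> sqrt (\<integral>x. (cmod (u x))\<^sup>2 \<partial>M) * sqrt (\<integral>x. (cmod (v x))\<^sup>2 \<partial>M)"
proof -
  have le: "cmod (u x) * cmod (v x) \<le> (cmod (u x))\<^sup>2 + (cmod (v x))\<^sup>2" for x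
  proof -
    have "2 * (cmod (u x) * cmod (v x)) \<le> (cmod (u x))\<^sup>2 + (cmod (v x))\<^sup>2"
      using sum_squares_bound[of "cmod (u x)" "cmod (v x)"] by (simp add: mult.assoc)
    moreover have "0 \<le> cmod (u x) * cmod (v x)" by simp
    ultimately show ?thesis by linarith
  qed
  show uv: "integrable M (\<lambda>x. u x * v x)"
    by (rule Bochner_Integration.integrable_bound[OF Bochner_Integration.integrable_add[OF u v]])
       (use le in \<open>auto simp: norm_mult\<close>)
  define a where "a = (\<integral>x. (cmod (u x))\<^sup>2 \<partial>M)"
  define b where "b = (\<integral>x. (cmod (v x))\<^sup>2 \<partial>M)"
  define s where "s = (\<integral>x. cmod (u x) * cmod (v x) \<partial>M)"
  have uv': "integrable M (\<lambda>x. cmod (u x) * cmod (v x))"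
    using integrable_norm[OF uv] by (simp add: norm_mult)
  have ab: "a \<ge> 0" "b \<ge> 0" "s \<ge> 0" by (simp_all add: a_def b_def s_def)
  have quad: "0 \<le> t\<^sup>2 * a - 2 * t * s + b" for t
  proof -
    have "0 \<le> (\<integral>x. (t * cmod (u x) - cmod (v x))\<^sup>2 \<partial>M)" by simp
    also have "\<dots> = (\<integral>x. t\<^sup>2 * (cmod (u x))\<^sup>2 - 2 * t * (cmod (u x) * cmod (v x)) + (cmod (v x))\<^sup>2 \<partial>M)"
      by (intro Bochner_Integration.integral_cong) (auto simp: power2_eq_square algebra_simps)
    also have "\<dots> = t\<^sup>2 * a - 2 * t * s + b"
      using u v uv' by (simp add: a_def b_def s_def)
    finally show ?thesis .
  qed
  have "s\<^sup>2 \<le> a * b"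
  proof (cases "a = 0")
    case True
    have "s = 0"
    proof (rule ccontr)
      assume "s \<noteq> 0"
      \<comment> \<open>The quadratic has degenerated to \<open>b - 2 * t * s\<close>, and this
        \<open>t\<close> makes it -1.\<close>
      then show False
        using quad[of "(b + 1) / (2 * s)"] True by (simp add: field_simps)
    qed
    then show ?thesis using ab by simp
  next
    case False
    \<comment> \<open>The quadratic is smallest at \<open>t = s / a\<close>.\<close>
    then have "0 \<le> (s / a)\<^sup>2 * a - 2 * (s / a) * s + b"
      by (intro quad)
    then show ?thesis
      using False ab by (simp add: power2_eq_square field_simps)
  qed
  then have "s \<le> sqrt (a * b)"
    by (rule real_le_rsqrt)
  moreover have "cmod (\<integral>x. u x * v x \<partial>M) \<le> s"
    unfolding s_def using integral_norm_bound[of M "\<lambda>x. u x * v x"] by (simp add: norm_mult)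
  ultimately show "cmod (\<integral>x. u x * v x \<partial>M) \<le> sqrt a * sqrt b"
    by (simp add: real_sqrt_mult)
qed

lemma periodic_fun_translate: "periodic_fun f \<Longrightarrow> periodic_fun (\<lambda>x. f (x + v))"
  unfolding periodic_fun_def by (metis add.assoc add.commute)

lemma norm_diff_sq_le: "(norm (x - y))\<^sup>2 \<le> 2 * (norm x)\<^sup>2 + 2 * (norm (y :: 'a::real_normed_vector))\<^sup>2"
proof -
  have "(norm (x - y))\<^sup>2 \<le> (norm x + norm y)\<^sup>2"
    by (intro power_mono norm_triangle_ineq4) simp
  also have "\<dots> \<le> 2 * (norm x)\<^sup>2 + 2 * (norm y)\<^sup>2"
    using sum_squares_bound[of "norm x" "norm y"] by (simp add: power2_sum)
  finally show ?thesis .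
qed

text \<open>The bound does not depend on \<open>v\<close>, so the norms in \<open>L2_modulus\<close>
  are bounded above. The factor 4 is 2 + 2: a translate has the same square integral as
  \<open>f\<close>.\<close>

lemma
  fixes f :: "real^'n \<Rightarrow> complex"
  assumes f [measurable]: "f \<in> borel_measurable borel" and per: "periodic_fun f"
    and sq: "integrable cube_mu (\<lambda>x. (cmod (f x))\<^sup>2)"
  shows integrable_translate_diff: "integrable cube_mu (\<lambda>x. (cmod (f (x + v) - f x))\<^sup>2)"
    and integral_translate_diff_le:
      "(\<integral>x. (cmod (f (x + v) - f x))\<^sup>2 \<partial>cube_mu) \<le> 4 * (\<integral>x. (cmod (f x))\<^sup>2 \<partial>cube_mu)"
proof -
  have per2: "periodic_fun (\<lambda>x. (cmod (f x))\<^sup>2)"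
    using per by (simp add: periodic_fun_def)
  have tr: "integrable cube_mu (\<lambda>x. (cmod (f (x + v)))\<^sup>2)"
    using integrable_cube_mu_translate[OF _ per2, of v] sq by simp
  have sum: "integrable cube_mu (\<lambda>x. 2 * (cmod (f (x + v)))\<^sup>2 + 2 * (cmod (f x))\<^sup>2)"
    using tr sq by simp
  show diff: "integrable cube_mu (\<lambda>x. (cmod (f (x + v) - f x))\<^sup>2)"
  proof (rule Bochner_Integration.integrable_bound[OF sum])
    show "AE x in cube_mu. norm ((cmod (f (x + v) - f x))\<^sup>2)
        \<le> norm (2 * (cmod (f (x + v)))\<^sup>2 + 2 * (cmod (f x))\<^sup>2)"
      using norm_diff_sq_le[of "f (_ + v)" "f _"] by (intro AE_I2) simp
  qed simp
  have "(\<integral>x. (cmod (f (x + v) - f x))\<^sup>2 \<partial>cube_mu)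
      \<le> (\<integral>x. 2 * (cmod (f (x + v)))\<^sup>2 + 2 * (cmod (f x))\<^sup>2 \<partial>cube_mu)"
    by (intro integral_mono diff sum norm_diff_sq_le)
  also have "\<dots> = 4 * (\<integral>x. (cmod (f x))\<^sup>2 \<partial>cube_mu)"
    using integral_cube_mu_translate[OF _ per2, of v] tr sq by simp
  finally show "(\<integral>x. (cmod (f (x + v) - f x))\<^sup>2 \<partial>cube_mu) \<le> 4 * (\<integral>x. (cmod (f x))\<^sup>2 \<partial>cube_mu)" .
qed

text \<open>\<open>N\<close> steps of length at most \<open>\<delta>\<close> reach every
  displacement \<open>s\<close> provided by \<open>approx\<close>, and each step costs at most
  \<open>\<omega>\<close> times the norm of \<open>g\<close>.\<close>

lemma correlation_le_modulus:
  fixes f g :: "real^'n \<Rightarrow> complex"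
  assumes f [measurable]: "f \<in> borel_measurable borel" and per_f: "periodic_fun f"
    and sq_f: "integrable cube_mu (\<lambda>x. (cmod (f x))\<^sup>2)"
    and g [measurable]: "g \<in> borel_measurable borel" and per_g: "periodic_fun g"
    and sq_g: "integrable cube_mu (\<lambda>x. (cmod (g x))\<^sup>2)"
    and L: "torus_endo L"
    and modulus: "\<And>v. norm v \<le> \<delta> \<Longrightarrow> sqrt (\<integral>x. (cmod (f (x + v) - f x))\<^sup>2 \<partial>cube_mu) \<le> \<omega>"
    and N: "N > 0"
    and approx: "\<And>y. \<exists>k s. int_vec k \<and> y = k + L s \<and> norm s \<le> real N * \<delta>"
  shows "cmod ((\<integral>x. f x * g (L x) \<partial>cube_mu) - (\<integral>x. f x \<partial>cube_mu) * (\<integral>x. g x \<partial>cube_mu))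
    \<le> real N * \<omega> * sqrt (\<integral>x. (cmod (g x))\<^sup>2 \<partial>cube_mu)"
proof -
  have L_meas [measurable]: "L \<in> borel_measurable borel" and lin: "linear L"
    using L by (auto simp: torus_endo_def intro: linear_borel_measurable)
  define G where "G = sqrt (\<integral>x. (cmod (g x))\<^sup>2 \<partial>cube_mu)"
  define I where "I w = (\<integral>x. f (x + w) * g (L x) \<partial>cube_mu)" for w
  have per_sq: "periodic_fun (\<lambda>x. (cmod (h x))\<^sup>2)" if "periodic_fun h" for h :: "real^'n \<Rightarrow> complex"
    using that by (simp add: periodic_fun_def)
  have sq_fw: "integrable cube_mu (\<lambda>x. (cmod (f (x + w)))\<^sup>2)" for w
    using integrable_cube_mu_translate[OF _ per_sq[OF per_f], of w] sq_f by simp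
  have sq_gL: "integrable cube_mu (\<lambda>x. (cmod (g (L x)))\<^sup>2)"
    using integrable_cube_mu_endo[OF _ per_sq[OF per_g] L] sq_g by simp
  have G: "sqrt (\<integral>x. (cmod (g (L x)))\<^sup>2 \<partial>cube_mu) = G"
    using integral_cube_mu_endo[OF _ per_sq[OF per_g] L] by (simp add: G_def)
  have int: "integrable cube_mu (\<lambda>x. f (x + w) * g (L x))" for w
    using sq_fw sq_gL by (intro integrable_mult_L2) simp_all
  have step: "cmod (I (w + v) - I w) \<le> \<omega> * G" if "norm v \<le> \<delta>" for w v
  proof -
    let ?d = "\<lambda>x. f (x + v) - f x"
    have per_d: "periodic_fun (\<lambda>x. (cmod (?d x))\<^sup>2)"
      by (rule per_sq) (use per_f periodic_fun_translate[OF per_f, of v] in \<open>simp add: periodic_fun_def\<close>)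
    have "I (w + v) - I w = (\<integral>x. f (x + (w + v)) * g (L x) - f (x + w) * g (L x) \<partial>cube_mu)"
      unfolding I_def by (rule Bochner_Integration.integral_diff[symmetric]) (rule int)+
    also have "\<dots> = (\<integral>x. ?d (x + w) * g (L x) \<partial>cube_mu)"
      by (simp add: algebra_simps)
    also have "cmod \<dots> \<le> sqrt (\<integral>x. (cmod (?d (x + w)))\<^sup>2 \<partial>cube_mu) * sqrt (\<integral>x. (cmod (g (L x)))\<^sup>2 \<partial>cube_mu)"
    proof (rule norm_integral_mult_le_L2)
      show "integrable cube_mu (\<lambda>x. (cmod (?d (x + w)))\<^sup>2)"
        using integrable_cube_mu_translate[OF _ per_d, of w]
          integrable_translate_diff[OF f per_f sq_f, of v] by simp
    qed (use sq_gL in simp_all)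
    \<comment> \<open>The translation by \<open>w\<close> and the composition with \<open>L\<close>
      drop out by invariance of the measure.\<close>
    also have "\<dots> = sqrt (\<integral>x. (cmod (?d x))\<^sup>2 \<partial>cube_mu) * G"
      using integral_cube_mu_translate[OF _ per_d, of w] by (simp add: G)
    also have "\<dots> \<le> \<omega> * G"
      using modulus[OF that] by (intro mult_right_mono) (simp_all add: G_def)
    finally show ?thesis .
  qed
  have steps: "cmod (I (real j *\<^sub>R v) - I 0) \<le> real j * (\<omega> * G)" if "norm v \<le> \<delta>" for j v
  proof (induction j)
    case (Suc j)
    have "cmod (I (real (Suc j) *\<^sub>R v) - I 0)
        \<le> cmod (I (real j *\<^sub>R v + v) - I (real j *\<^sub>R v)) + cmod (I (real j *\<^sub>R v) - I 0)"
      using norm_triangle_ineq[of "I (real j *\<^sub>R v + v) - I (real j *\<^sub>R v)" "I (real j *\<^sub>R v) - I 0"]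
      by (simp add: scaleR_add_left add.commute)
    with Suc step[OF that, of "real j *\<^sub>R v"] show ?case
      by (simp add: algebra_simps)
  qed simp
  have I_bound: "cmod (I 0 - I w) \<le> real N * \<omega> * G" for w
  proof -
    obtain k s where k: "int_vec k" "L w = k + L s" "norm s \<le> real N * \<delta>"
      using approx by blast
    \<comment> \<open>\<open>L p\<close> is integral, so \<open>g \<circ> L\<close> is invariant
      under translation by \<open>p\<close>; the change of variable by \<open>- p\<close> replaces
      the displacement \<open>w\<close> by \<open>s\<close>.\<close>
    define p where "p = w - s"
    have Lp: "L p = k"
      using k(2) by (simp add: p_def linear_diff[OF lin])
    let ?h = "\<lambda>x. f (x + w) * g (L x)"
    have "periodic_fun ?h"
      using periodic_fun_translate[OF per_f, of w] periodic_fun_endo[OF L per_g]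
      by (simp add: periodic_fun_def)
    then have "I w = (\<integral>x. ?h (x + - p) \<partial>cube_mu)"
      unfolding I_def by (intro integral_cube_mu_translate[symmetric]) simp_all
    also have "\<dots> = I s"
    proof -
      have "g (L (x + - p)) = g (L x)" for x
        using per_g int_vec_minus[OF k(1)] unfolding periodic_fun_def
        by (metis Lp linear_diff[OF lin] add_uminus_conv_diff)
      moreover have "x + - p + w = x + s" for x
        by (simp add: p_def)
      ultimately show ?thesis
        by (simp only: I_def)
    qed
    \<comment> \<open>The displacement \<open>s\<close> is divided into \<open>N\<close> equal
      steps.\<close>
    finally have "I w = I (real N *\<^sub>R (s /\<^sub>R real N))"
      using N by simp
    moreover have "norm (s /\<^sub>R real N) \<le> \<delta>"
      using k(3) N by (simp add: field_simps)
    ultimately show ?thesis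
      using steps[of "s /\<^sub>R real N" N] by (simp add: norm_minus_commute mult.assoc)
  qed
  have int_f: "integrable cube_mu f"
    using integrable_mult_L2[of f cube_mu "\<lambda>_. 1"] sq_f by simp
  have int_g: "integrable cube_mu g"
    using integrable_mult_L2[of g cube_mu "\<lambda>_. 1"] sq_g by simp
  have int_gL: "integrable cube_mu (\<lambda>x. g (L x))"
    using int_g integrable_cube_mu_endo[OF g per_g L] by simp
  interpret P: pair_sigma_finite "cube_mu :: (real^'n) measure" "cube_mu :: (real^'n) measure" ..
  have shift: "(\<integral>w. cmod (f (x + w)) \<partial>cube_mu) = (\<integral>w. cmod (f w) \<partial>cube_mu)"
    "(\<integral>w. f (x + w) \<partial>cube_mu) = (\<integral>w. f w \<partial>cube_mu)"
    "integrable cube_mu (\<lambda>w. f (x + w))" for x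
    using integral_cube_mu_translate[of "\<lambda>w. cmod (f w)" x] integral_cube_mu_translate[OF f per_f, of x]
      integrable_cube_mu_translate[OF f per_f, of x] per_f int_f
    by (simp_all add: periodic_fun_def add.commute[of x])
  \<comment> \<open>The inner integral of a translate of \<open>cmod \<circ> f\<close> does not
    depend on \<open>x\<close>, so joint integrability reduces to that of
    \<open>g \<circ> L\<close>.\<close>
  have joint: "integrable (cube_mu \<Otimes>\<^sub>M cube_mu) (\<lambda>(x, w). f (x + w) * g (L x))"
  proof (rule P.Fubini_integrable)
    show "integrable cube_mu (\<lambda>x. \<integral>w. norm (case (x, w) of (x, w) \<Rightarrow> f (x + w) * g (L x)) \<partial>cube_mu)"
      using int_gL by (simp add: norm_mult shift)
    show "AE x in cube_mu. integrable cube_mu (\<lambda>w. case (x, w) of (x, w) \<Rightarrow> f (x + w) * g (L x))"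
      by (simp add: shift)
  qed simp
  have avg: "(\<integral>w. I w \<partial>cube_mu) = (\<integral>x. f x \<partial>cube_mu) * (\<integral>x. g x \<partial>cube_mu)"
  proof -
    have "(\<integral>w. I w \<partial>cube_mu) = (\<integral>x. (\<integral>w. f (x + w) * g (L x) \<partial>cube_mu) \<partial>cube_mu)"
      unfolding I_def by (rule P.Fubini_integral[OF joint])
    also have "\<dots> = (\<integral>x. f x \<partial>cube_mu) * (\<integral>x. g (L x) \<partial>cube_mu)"
      by (simp add: shift)
    finally show ?thesis
      by (simp add: integral_cube_mu_endo[OF g per_g L])
  qed
  have int_I: "integrable cube_mu I"
    unfolding I_def using P.integrable_snd[OF joint] by simp
  \<comment> \<open>Total mass 1 makes the deviation from the average equal to the average
    deviation.\<close>
  have "cmod (I 0 - (\<integral>w. I w \<partial>cube_mu)) = cmod (\<integral>w. I 0 - I w \<partial>cube_mu)"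
    using int_I by (simp add: measure_cube_mu)
  also have "\<dots> \<le> (\<integral>w. real N * \<omega> * G \<partial>(cube_mu :: (real^'n) measure))"
    using int_I I_bound by (intro Bochner_Integration.integral_norm_bound_integral) auto
  also have "\<dots> = real N * \<omega> * G" by (simp add: measure_cube_mu)
  finally show ?thesis
    unfolding avg by (simp add: I_def G_def)
qed

section \<open>Passage from Lebesgue measurable functions to Borel representatives\<close>

lemma AE_lebesgue_linear_add:
  fixes L :: "real^'n \<Rightarrow> real^'n"
  assumes L: "linear L" "surj L" and ae: "AE x in lebesgue. P x"
  shows "AE x in lebesgue. P (L x + v)"
proof -
  obtain N where N: "negligible N" "\<And>x. x \<notin> N \<Longrightarrow> P x"
    using ae unfolding completion.AE_iff_null_sets negligible_iff_null_sets by auto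
  have inj: "inj L"
    using L linear_surjective_imp_injective by blast
  then have lin: "linear (inv L)"
    using L inj_linear_imp_inv_linear by blast
  have "negligible ((+) (- v) ` N)"
    using N(1) by (rule negligible_translation)
  \<comment> \<open>This is the preimage of \<open>N\<close> under \<open>x -> L x + v\<close>, null
    because it is the image of a null set under a linear map.\<close>
  then have "negligible (inv L ` ((+) (- v) ` N))"
    by (rule negligible_differentiable_image_negligible[rotated])
       (auto intro: linear_imp_differentiable_on lin)
  moreover have "P (L x + v)" if "x \<notin> inv L ` ((+) (- v) ` N)" for x
  proof (rule N(2), rule notI)
    assume "L x + v \<in> N"
    then have "- v + (L x + v) \<in> (+) (- v) ` N" by (rule imageI)
    then have "inv L (L x) \<in> inv L ` ((+) (- v) ` N)" by (intro imageI) simp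
    then show False using that inj by simp
  qed
  ultimately show ?thesis
    unfolding negligible_iff_null_sets by (intro AE_I') auto
qed

text \<open>A Borel function equal to \<open>f\<close> almost everywhere need not be periodic;
  composing it with \<open>frac_vec\<close> makes it so.\<close>

lemma ex_borel_periodic_modification:
  fixes f :: "real^'n \<Rightarrow> complex"
  assumes f: "f \<in> borel_measurable lebesgue" and per: "periodic_fun f"
  shows "\<exists>f'. f' \<in> borel_measurable borel \<and> periodic_fun f' \<and> (AE x in lebesgue. f x = f' x)"
proof -
  obtain r where r [measurable]: "r \<in> borel_measurable lborel" "AE x in lborel. Re (f x) = r x"
    using completion_ex_borel_measurable_real[of "\<lambda>x. Re (f x)" lborel] f by auto
  obtain s where s [measurable]: "s \<in> borel_measurable lborel" "AE x in lborel. Im (f x) = s x"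
    using completion_ex_borel_measurable_real[of "\<lambda>x. Im (f x)" lborel] f by auto
  define f0 where "f0 x = Complex (r x) (s x)" for x
  have f0 [measurable]: "f0 \<in> borel_measurable borel"
  proof -
    have "f0 = (\<lambda>x. of_real (r x) + \<i> * of_real (s x))"
      by (simp add: f0_def Complex_eq fun_eq_iff)
    also have "\<dots> \<in> borel_measurable borel" using r(1) s(1) by measurable
    finally show ?thesis .
  qed
  have "AE x in lebesgue. f x = f0 x"
    using AE_completion[OF r(2)] AE_completion[OF s(2)]
    by eventually_elim (simp add: f0_def complex_eq_iff)
  then obtain N where N: "negligible N" "\<And>x. x \<notin> N \<Longrightarrow> f x = f0 x"
    unfolding completion.AE_iff_null_sets negligible_iff_null_sets by auto
  \<comment> \<open>All integer translates of the exceptional set are discarded; there are countably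
    many, so their union is still null.\<close>
  define N' where "N' = (\<Union>k\<in>{k. int_vec k}. (+) k ` N)"
  have "negligible N'"
    unfolding N'_def using countable_int_vec
    by (intro negligible_countable_Union) (auto intro: negligible_translation N)
  moreover have "f x = f0 (frac_vec x)" if "x \<notin> N'" for x
  proof -
    have "frac_vec x \<notin> N"
    proof
      assume "frac_vec x \<in> N"
      then have "floor_vec x + frac_vec x \<in> N'"
        unfolding N'_def using int_vec_floor_vec by blast
      with that show False by (simp add: frac_floor_vec)
    qed
    then show ?thesis
      using N(2) periodic_fun_frac[OF per, of x] by simp
  qed
  ultimately have "AE x in lebesgue. f x = f0 (frac_vec x)"
    unfolding negligible_iff_null_sets by (intro AE_I') auto
  moreover have "periodic_fun (\<lambda>x. f0 (frac_vec x))"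
    using frac_vec_periodic[where 'n = 'n] by (simp add: periodic_fun_def)
  ultimately show ?thesis
    by (intro exI[of _ "\<lambda>x. f0 (frac_vec x)"]) simp
qed

text \<open>A nonzero real vector killed by \<open>A\<close> would be a complex eigenvector for 0,
  so \<open>A\<close> is injective and hence surjective.\<close>

lemma torus_endo_funpow:
  fixes A :: "real^'n^'n"
  assumes A: "int_matrix A" and 0: "0 \<notin> eigenvalues A"
  shows "torus_endo ((*v) A ^^ n)"
proof -
  have "x = 0" if "A *v x = 0" for x
  proof -
    have "cmatrix A *v of_real_vec x = of_real_vec (A *v x)"
      by (simp add: vec_eq_iff cmatrix_def of_real_vec_def matrix_vector_mult_def)
    also have "\<dots> = 0 *s of_real_vec x"
      by (simp add: that of_real_vec_def vec_eq_iff)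
    finally have "of_real_vec x = 0"
      using 0 by (auto simp: eigenvalues_def)
    then show ?thesis by (simp add: of_real_vec_def vec_eq_iff)
  qed
  then have "inj ((*v) A)"
    using linear_injective_0[OF matrix_vector_mul_linear] by blast
  then have surj: "surj ((*v) A)"
    using linear_injective_imp_surjective[OF matrix_vector_mul_linear] by blast
  show ?thesis
  proof (induction n)
    case 0
    show ?case by (simp add: torus_endo_def linear_id linear_ident)
  next
    case (Suc n)
    have "linear ((*v) A \<circ> ((*v) A ^^ n))"
      using Suc by (intro linear_compose) (simp_all add: torus_endo_def)
    moreover have "surj ((*v) A \<circ> ((*v) A ^^ n))"
      using Suc by (intro comp_surj surj) (simp add: torus_endo_def)
    ultimately show ?case
      using Suc int_vec_matrix[OF A] unfolding torus_endo_def funpow.simps(2) by (metis comp_apply)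
  qed
qed

text \<open>Every integral involved is unchanged when \<open>f\<close> and \<open>g\<close> are
  replaced by Borel periodic representatives and \<open>torus_mu\<close> by
  \<open>cube_mu\<close>.\<close>

lemma correlation_le_L2_modulus:
  fixes A :: "real^'n^'n"
  assumes f: "f \<in> L2_torus" and g: "g \<in> L2_torus" and L: "torus_endo ((*v) A ^^ n)"
    and N: "N > 0" and \<delta>: "\<delta> \<ge> 0"
    and approx: "\<And>y. \<exists>k s. int_vec k \<and> y = k + ((*v) A ^^ n) s \<and> norm s \<le> real N * \<delta>"
  shows "cmod (correlation A f g n) \<le> real N * L2_norm g * L2_modulus f \<delta>"
proof -
  let ?L = "(*v) A ^^ n"
  have lin: "linear ?L" "surj ?L" using L by (auto simp: torus_endo_def)
  have [measurable]: "?L \<in> borel_measurable borel"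
    by (rule linear_borel_measurable) fact
  obtain f' where f' [measurable]: "f' \<in> borel_measurable borel" and per_f: "periodic_fun f'"
    and ae_f: "AE x in lebesgue. f x = f' x"
    using ex_borel_periodic_modification f by (auto simp: L2_torus_def)
  obtain g' where g' [measurable]: "g' \<in> borel_measurable borel" and per_g: "periodic_fun g'"
    and ae_g: "AE x in lebesgue. g x = g' x"
    using ex_borel_periodic_modification g by (auto simp: L2_torus_def)
  have sq: "AE x in lebesgue. (cmod (f x))\<^sup>2 = (cmod (f' x))\<^sup>2"
    "AE x in lebesgue. (cmod (g x))\<^sup>2 = (cmod (g' x))\<^sup>2"
    using ae_f ae_g by (eventually_elim, simp)+
  have sq_f: "integrable cube_mu (\<lambda>x. (cmod (f' x))\<^sup>2)"
    using f torus_mu_cube_mu(1)[OF sq(1)] by (simp add: L2_torus_def)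
  have sq_g: "integrable cube_mu (\<lambda>x. (cmod (g' x))\<^sup>2)"
    using g torus_mu_cube_mu(1)[OF sq(2)] by (simp add: L2_torus_def)
  have norm_g: "L2_norm g = sqrt (\<integral>x. (cmod (g' x))\<^sup>2 \<partial>cube_mu)"
    using torus_mu_cube_mu(2)[OF sq(2)] by (simp add: L2_norm_def)
  have diff: "L2_norm (\<lambda>x. f (x + v) - f x) = sqrt (\<integral>x. (cmod (f' (x + v) - f' x))\<^sup>2 \<partial>cube_mu)" for v
  proof -
    have "AE x in lebesgue. f (id x + v) = f' (id x + v)"
      by (rule AE_lebesgue_linear_add[OF linear_id surj_id ae_f])
    then have "AE x in lebesgue. f (x + v) = f' (x + v)"
      by simp
    with ae_f have "AE x in lebesgue. (cmod (f (x + v) - f x))\<^sup>2 = (cmod (f' (x + v) - f' x))\<^sup>2"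
      by eventually_elim simp
    then show ?thesis
      unfolding L2_norm_def by (subst torus_mu_cube_mu(2)) simp_all
  qed
  have "AE x in lebesgue. g (?L x + 0) = g' (?L x + 0)"
    by (rule AE_lebesgue_linear_add[OF lin ae_g])
  with ae_f have ae_fg: "AE x in lebesgue. f x * g (?L x) = f' x * g' (?L x)"
    by eventually_elim simp
  have corr: "correlation A f g n
      = (\<integral>x. f' x * g' (?L x) \<partial>cube_mu) - (\<integral>x. f' x \<partial>cube_mu) * (\<integral>x. g' x \<partial>cube_mu)"
    unfolding correlation_def
    using torus_mu_cube_mu(2)[OF ae_fg] torus_mu_cube_mu(2)[OF ae_f] torus_mu_cube_mu(2)[OF ae_g]
    by simp
  \<comment> \<open>A real \<open>Sup\<close> is known to dominate the members of its set only once
    the set is bounded above.\<close>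
  have "L2_norm (\<lambda>x. f (x + v) - f x) \<le> sqrt (4 * (\<integral>x. (cmod (f' x))\<^sup>2 \<partial>cube_mu))" for v
    unfolding diff by (intro real_sqrt_le_mono integral_translate_diff_le f' per_f sq_f)
  then have bdd: "bdd_above {L2_norm (\<lambda>x. f (x + v) - f x) | v. norm v \<le> \<delta>}"
    by (intro bdd_aboveI) auto
  have "cmod (correlation A f g n) \<le> real N * L2_modulus f \<delta> * L2_norm g"
    unfolding corr norm_g
  proof (rule correlation_le_modulus[OF f' per_f sq_f g' per_g sq_g L _ N approx])
    fix v :: "real^'n" assume "norm v \<le> \<delta>"
    then have "L2_norm (\<lambda>x. f (x + v) - f x) \<le> L2_modulus f \<delta>"
      unfolding L2_modulus_def using bdd by (intro cSup_upper) auto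
    then show "sqrt (\<integral>x. (cmod (f' (x + v) - f' x))\<^sup>2 \<partial>cube_mu) \<le> L2_modulus f \<delta>"
      by (simp add: diff)
  qed
  then show ?thesis by (simp add: mult_ac)
qed

theorem theorem1:
  fixes A :: "real^'n^'n" and lam :: real
  assumes "int_matrix A" and "expanding A"
    and "lam \<in> cmod ` eigenvalues A" and "\<forall>z \<in> eigenvalues A. lam \<le> cmod z"
    and "lam > 1"
  shows "\<exists>C>0. \<forall>f \<in> L2_torus. \<forall>g \<in> L2_torus. \<forall>n::nat. n \<ge> 1 \<longrightarrow>
           cmod (correlation A f g n) \<le> C * L2_norm g * L2_modulus f (lam powr (- real n))"
proof -
  have "eigenvalues A \<noteq> {}" using assms(3) by blast
  then obtain R where R: "\<And>n y. \<exists>k s. int_vec k \<and> y = k + ((*v) A ^^ n) s \<and> norm s \<le> R / lam ^ n"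
    using int_approximation[OF assms(1), of lam] assms(4,5) by auto
  \<comment> \<open>A positive integer at least \<open>R\<close>, also when \<open>R\<close> is
    negative and \<open>nat\<close> returns 0; it becomes the constant \<open>C\<close>.\<close>
  define N where "N = Suc (nat \<lceil>R\<rceil>)"
  have "0 \<notin> eigenvalues A"
    using assms(2) by (force simp: expanding_def)
  note endo = torus_endo_funpow[OF assms(1) this]
  have approx: "\<exists>k s. int_vec k \<and> y = k + ((*v) A ^^ n) s \<and> norm s \<le> real N * (lam powr (- real n))" for n y
  proof -
    have "R \<le> real N" unfolding N_def by linarith
    then have "R / lam ^ n \<le> real N * (lam powr (- real n))"
      using assms(5) by (simp add: powr_minus powr_realpow divide_inverse)
    then show ?thesis using R[of y n] order_trans by blast
  qed
  have "cmod (correlation A f g n) \<le> real N * L2_norm g * L2_modulus f (lam powr (- real n))"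
    if "f \<in> L2_torus" "g \<in> L2_torus" for f g n
    using that endo approx by (intro correlation_le_L2_modulus) (simp_all add: N_def)
  then show ?thesis
    by (intro exI[of _ "real N"]) (simp add: N_def)
qed

end
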